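(* Let $\mathcal{D}_Y=\sum_{w\in Y^*}w\otimes w$ be the diagonal series over $Y$. Then: (1) $\displaystyle\log\mathcal{D}_Y=\sum_{w\in Y^+}w\otimes\pi_1(w)=\sum_{w\in Y^+}\check\pi_1(w)\otimes w.$ (2) For any $w\in Y^*$, $$w=\sum_{k\ge0}\frac1{k!}\sum_{u_1,\dots,u_k\in Y^+}\langle w\mid u_1\star\cdots\star u_k\rangle\,\pi_1(u_1)\cdots\pi_1(u_k)=\sum_{k\ge0}\frac1{k!}\sum_{u_1,\dots,u_k\in Y^+}\langle w\mid u_1\cdots u_k\rangle\,\check\pi_1(u_1)\star\cdots\star\check\pi_1(u_k).$$ In particular, for any $y_s\in Y$, $$y_s=\sum_{k\ge1}\frac{q^{k-1}}{k!}\sum_{s'_1+\cdots+s'_k=s}\pi_1(y_{s'_1})\cdots\pi_1(y_{s'_k})\quad\text{and}\quad y_s=\check\pi_1(y_s),$$ where the $s'_j$ are integers $\ge1$.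
   Context: Let $\mathbf{k}$ be a commutative unital $\mathbb{Q}$-algebra and $q\in\mathbf{k}$. Let $Y=\{y_s\}_{s\ge1}$ be an alphabet; $Y^*$ is the set of words, $1_{Y^*}$ the empty word, $Y^+=Y^*\setminus\{1_{Y^*}\}$, $\mathbf{k}\langle Y\rangle$ the noncommutative polynomials. $\langle P\mid w\rangle$ is the coefficient of the word $w$ in $P$, extended to a bilinear pairing for which words are orthonormal. The $q$-stuffle product $\star$ is the bilinear product on $\mathbf{k}\langle Y\rangle$ with $u\star 1_{Y^*}=1_{Y^*}\star u=u$ and $y_su\star y_tv=y_s(u\star y_tv)+y_t(y_su\star v)+q\,y_{s+t}(u\star v)$; it is commutative, associative and unital, and homogeneous for the weight (the weight of $y_{i_1}\cdots y_{i_r}$ is $i_1+\cdots+i_r$). For $w\in Y^+$ set $$\pi_1(w)=w+\sum_{k\ge2}\frac{(-1)^{k-1}}{k}\sum_{u_1,\dots,u_k\in Y^+}\langle w\mid u_1\star\cdots\star u_k\rangle\,u_1\cdots u_k,$$ $$\check\pi_1(w)=w+\sum_{k\ge2}\frac{(-1)^{k-1}}{k}\sum_{u_1,\dots,u_k\in Y^+}\langle w\mid u_1\cdots u_k\rangle\,u_1\star\cdots\star u_k.$$ The series $\mathcal{D}_Y$ and its logarithm live in the weight-completion of $\mathbf{k}\langle Y\rangle\otimes\mathbf{k}\langle Y\rangle$, with multiplication $\star$ on the left factor and concatenation on the right factor. Empty products ($k=0$) equal $1_{Y^*}$. *)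

theory Defs
  imports Complex_Main "HOL-Library.Poly_Mapping"
begin

section \<open>Coefficients: commutative unital \<open>\<rat>\<close>-algebras\<close>

class rat_algebra_1 = comm_ring_1 +
  fixes scaleQ :: "rat \<Rightarrow> 'a \<Rightarrow> 'a"
  assumes scaleQ_add_right: "scaleQ r (x + y) = scaleQ r x + scaleQ r y"
    and scaleQ_add_left: "scaleQ (r + s) x = scaleQ r x + scaleQ s x"
    and scaleQ_scaleQ: "scaleQ r (scaleQ s x) = scaleQ (r * s) x"
    and scaleQ_one: "scaleQ 1 x = x"
    and scaleQ_mult_left: "scaleQ r x * y = scaleQ r (x * y)"

definition rat_scalar :: "rat \<Rightarrow> 'k::rat_algebra_1" where
  "rat_scalar r = scaleQ r 1"

instantiation rat :: rat_algebra_1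
begin

definition scaleQ_rat :: "rat \<Rightarrow> rat \<Rightarrow> rat" where
  "scaleQ_rat = (*)"

instance
  by standard (simp_all add: scaleQ_rat_def algebra_simps)

end


section \<open>Words and noncommutative polynomials\<close>

text \<open>The letter \<open>y s\<close> is meaningful only for \<open>s \<ge> 1\<close>.\<close>

typedef letter = "{s :: nat. 1 \<le> s}"
  morphisms index y
  by auto

type_synonym word = "letter list"

definition weight :: "word \<Rightarrow> nat" where
  "weight w = (\<Sum>a\<leftarrow>w. index a)"

definition Yplus :: "word set" where
  "Yplus = {w. w \<noteq> []}"

definition tuples :: "nat \<Rightarrow> word list set" where
  "tuples k = {us. length us = k \<and> set us \<subseteq> Yplus}"

text \<open>
  Lists under concatenation are made a (noncommutative) monoid, written additively
  as required by \<^theory>\<open>HOL-Library.Poly_Mapping\<close>. The library product \<open>*\<close> on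
  finitely supported functions is then the concatenation product of
  noncommutative polynomials, with unit the empty word.
\<close>

instantiation list :: (type) monoid_add
begin

definition zero_list :: "'a list" where
  "zero_list = []"

definition plus_list :: "'a list \<Rightarrow> 'a list \<Rightarrow> 'a list" where
  "plus_list u v = u @ v"

instance
  by standard (simp_all add: zero_list_def plus_list_def)

end

type_synonym 'k ncpoly = "word \<Rightarrow>\<^sub>0 'k"

definition word :: "word \<Rightarrow> 'k::rat_algebra_1 ncpoly" where
  "word w = Poly_Mapping.single w 1"

definition smult :: "'k \<Rightarrow> 'k ncpoly \<Rightarrow> 'k::rat_algebra_1 ncpoly" where
  "smult c P = Poly_Mapping.map ((*) c) P"

definition pairing :: "'k ncpoly \<Rightarrow> 'k ncpoly \<Rightarrow> 'k::rat_algebra_1" where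
  "pairing P Q = (\<Sum>w\<in>Poly_Mapping.keys P. Poly_Mapping.lookup P w * Poly_Mapping.lookup Q w)"

text \<open>
  Sum over a possibly infinite index set of a family with finitely many nonzero
  members. The library's \<^const>\<open>Sum_any\<close> is \<open>0\<close> on families of infinite support;
  the families occurring below are shown to have finite support.
\<close>

definition fsum :: "'i set \<Rightarrow> ('i \<Rightarrow> 'b) \<Rightarrow> 'b::comm_monoid_add" where
  "fsum A f = Sum_any (\<lambda>i. f i when i \<in> A)"


section \<open>The \<open>q\<close>-stuffle product\<close>

fun stuffle_words :: "'k \<Rightarrow> word \<Rightarrow> word \<Rightarrow> 'k::rat_algebra_1 ncpoly" where
  "stuffle_words q u [] = word u"
| "stuffle_words q [] v = word v"
| "stuffle_words q (a # u) (b # v) =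
     word [a] * stuffle_words q u (b # v)
     + word [b] * stuffle_words q (a # u) v
     + smult q (word [y (index a + index b)] * stuffle_words q u v)"

definition stuffle :: "'k \<Rightarrow> 'k ncpoly \<Rightarrow> 'k ncpoly \<Rightarrow> 'k::rat_algebra_1 ncpoly" where
  "stuffle q P Q =
     (\<Sum>u\<in>Poly_Mapping.keys P. \<Sum>v\<in>Poly_Mapping.keys Q. smult (Poly_Mapping.lookup P u * Poly_Mapping.lookup Q v) (stuffle_words q u v))"

definition stuffle_list :: "'k \<Rightarrow> 'k ncpoly list \<Rightarrow> 'k::rat_algebra_1 ncpoly" where
  "stuffle_list q Ps = foldr (stuffle q) Ps 1"


section \<open>The maps \<open>\<pi>\<^sub>1\<close> and its dual\<close>

definition pi1 :: "'k \<Rightarrow> word \<Rightarrow> 'k::rat_algebra_1 ncpoly" where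
  "pi1 q w = word w +
     fsum {2..} (\<lambda>k. smult (rat_scalar ((- 1) ^ (k - 1) / of_nat k))
       (fsum (tuples k) (\<lambda>us.
          smult (pairing (word w) (stuffle_list q (map word us)))
            (prod_list (map word us)))))"

definition pi1_check :: "'k \<Rightarrow> word \<Rightarrow> 'k::rat_algebra_1 ncpoly" where
  "pi1_check q w = word w +
     fsum {2..} (\<lambda>k. smult (rat_scalar ((- 1) ^ (k - 1) / of_nat k))
       (fsum (tuples k) (\<lambda>us.
          smult (pairing (word w) (prod_list (map word us)))
            (stuffle_list q (map word us)))))"


section \<open>The completed tensor product\<close>

text \<open>
  There are only finitely many words of each weight. Hence the weight completion of
  the tensor square of the noncommutative polynomials consists of all families of
  coefficients indexed by pairs of words: \<open>S u v\<close> is the coefficient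
  of \<open>u \<otimes> v\<close> in \<open>S\<close>. Infinite sums and the logarithm are taken coefficientwise.
\<close>

type_synonym 'k tensor_series = "word \<Rightarrow> word \<Rightarrow> 'k"

definition tensor :: "'k ncpoly \<Rightarrow> 'k ncpoly \<Rightarrow> 'k::rat_algebra_1 tensor_series" where
  "tensor P Q = (\<lambda>u v. Poly_Mapping.lookup P u * Poly_Mapping.lookup Q v)"

definition ts_sum :: "'i set \<Rightarrow> ('i \<Rightarrow> 'k tensor_series) \<Rightarrow> 'k::rat_algebra_1 tensor_series" where
  "ts_sum A F = (\<lambda>u v. fsum A (\<lambda>i. F i u v))"

text \<open>Stuffle product on the left factor, concatenation on the right factor.\<close>

definition ts_mult ::
  "'k \<Rightarrow> 'k tensor_series \<Rightarrow> 'k tensor_series \<Rightarrow> 'k::rat_algebra_1 tensor_series" where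
  "ts_mult q S T = (\<lambda>u v. fsum UNIV (\<lambda>((u\<^sub>1, v\<^sub>1), (u\<^sub>2, v\<^sub>2)).
     S u\<^sub>1 v\<^sub>1 * T u\<^sub>2 v\<^sub>2 *
     tensor (stuffle q (word u\<^sub>1) (word u\<^sub>2)) (word v\<^sub>1 * word v\<^sub>2) u v))"

definition ts_one :: "'k::rat_algebra_1 tensor_series" where
  "ts_one = tensor 1 1"

definition ts_power :: "'k \<Rightarrow> 'k tensor_series \<Rightarrow> nat \<Rightarrow> 'k::rat_algebra_1 tensor_series" where
  "ts_power q S k = (ts_mult q S ^^ k) ts_one"

text \<open>The logarithm of a series with constant term \<open>1\<close>.\<close>

definition ts_log :: "'k \<Rightarrow> 'k tensor_series \<Rightarrow> 'k::rat_algebra_1 tensor_series" where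
  "ts_log q S = ts_sum {1..} (\<lambda>k u v.
     rat_scalar ((- 1) ^ (k - 1) / of_nat k) *
     ts_power q (\<lambda>u v. S u v - ts_one u v) k u v)"

definition diagonal :: "'k::rat_algebra_1 tensor_series" where
  "diagonal = ts_sum UNIV (\<lambda>w. tensor (word w) (word w))"


section \<open>Finiteness of the supports\<close>

lemma lookup_word: "Poly_Mapping.lookup (word w) v = (1 when w = v)"
  by (simp add: word_def lookup_single)

lemma lookup_smult: "Poly_Mapping.lookup (smult c P) w = c * Poly_Mapping.lookup P w"
  by (simp add: smult_def map.rep_eq when_def)

lemma smult_0 [simp]: "smult 0 P = 0"
  by (rule poly_mapping_eqI) (simp add: lookup_smult)

lemma smult_zero_right [simp]: "smult c 0 = 0"
  by (rule poly_mapping_eqI) (simp add: lookup_smult)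

lemma one_eq_word: "1 = word []"
  by (simp add: word_def zero_list_def flip: single_one)

lemma word_mult: "word u * word v = word (u @ v)"
  by (simp add: word_def mult_single plus_list_def)

lemma prod_list_word: "prod_list (map word us) = word (concat us)"
  by (induction us) (simp_all add: one_eq_word word_mult)

lemma keys_word: "Poly_Mapping.keys (word w :: 'k::rat_algebra_1 ncpoly) = {w}"
  by (simp add: word_def)

lemma pairing_word: "pairing (word w) P = Poly_Mapping.lookup P w"
  by (simp add: pairing_def keys_word lookup_word)

lemma index_pos: "1 \<le> index a"
  using index[of a] by simp

lemma weight_Nil [simp]: "weight [] = 0"
  by (simp add: weight_def)

lemma weight_Cons [simp]: "weight (a # w) = index a + weight w"
  by (simp add: weight_def)

lemma weight_append [simp]: "weight (u @ v) = weight u + weight v"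
  by (simp add: weight_def)

lemma weight_Yplus: "w \<in> Yplus \<Longrightarrow> 1 \<le> weight w"
  using index_pos by (cases w) (auto simp: Yplus_def intro: order_trans trans_le_add1)

lemma keys_smult: "Poly_Mapping.keys (smult c P) \<subseteq> Poly_Mapping.keys P"
  by (auto simp: in_keys_iff lookup_smult)

lemma keys_letter_mult:
  "w \<in> Poly_Mapping.keys (word [a] * P) \<Longrightarrow> \<exists>v\<in>Poly_Mapping.keys P. w = a # v"
  using keys_mult[of "word [a]" P] by (auto simp: keys_word plus_list_def)

lemma weight_stuffle_words:
  "w \<in> Poly_Mapping.keys (stuffle_words q u v) \<Longrightarrow> weight w = weight u + weight v"
proof (induction q u v arbitrary: w rule: stuffle_words.induct)
  case (3 q a u b v)
  let ?A = "word [a] * stuffle_words q u (b # v)"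
  let ?B = "word [b] * stuffle_words q (a # u) v"
  let ?C = "word [y (index a + index b)] * stuffle_words q u v"
  have "w \<in> Poly_Mapping.keys ?A \<union> Poly_Mapping.keys ?B \<union> Poly_Mapping.keys (smult q ?C)"
    using "3.prems" Poly_Mapping.keys_add[of "?A + ?B" "smult q ?C"] Poly_Mapping.keys_add[of ?A ?B]
    by auto
  then consider "w \<in> Poly_Mapping.keys ?A" | "w \<in> Poly_Mapping.keys ?B" | "w \<in> Poly_Mapping.keys ?C"
    using keys_smult[of q ?C] by blast
  then show ?case
  proof cases
    case 1
    then show ?thesis using "3.IH"(1) by (auto dest!: keys_letter_mult)
  next
    case 2
    then show ?thesis using "3.IH"(2) by (auto dest!: keys_letter_mult)
  next
    case 3
    have "index (y (index a + index b)) = index a + index b"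
      using index_pos[of a] by (simp add: y_inverse)
    with 3 show ?thesis using "3.IH"(3) by (auto dest!: keys_letter_mult)
  qed
qed (simp_all add: keys_word)

lemma keys_stuffle:
  assumes "w \<in> Poly_Mapping.keys (stuffle q P Q)"
  obtains u v where "u \<in> Poly_Mapping.keys P" "v \<in> Poly_Mapping.keys Q"
    "weight w = weight u + weight v"
proof -
  have "Poly_Mapping.keys (stuffle q P Q) \<subseteq>
      (\<Union>u\<in>Poly_Mapping.keys P. \<Union>v\<in>Poly_Mapping.keys Q.
        Poly_Mapping.keys (stuffle_words q u v))"
    unfolding stuffle_def
    by (intro order_trans[OF keys_sum] UN_mono subset_refl keys_smult)
  with assms obtain u v where "u \<in> Poly_Mapping.keys P" "v \<in> Poly_Mapping.keys Q"
    "w \<in> Poly_Mapping.keys (stuffle_words q u v)"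
    by blast
  with that weight_stuffle_words show thesis by blast
qed

lemma weight_stuffle_list:
  "w \<in> Poly_Mapping.keys (stuffle_list q (map word us)) \<Longrightarrow> weight w = (\<Sum>u\<leftarrow>us. weight u)"
proof (induction us arbitrary: w)
  case Nil
  then show ?case by (simp add: stuffle_list_def one_eq_word keys_word)
next
  case (Cons u us)
  from Cons.prems have "w \<in> Poly_Mapping.keys (stuffle q (word u) (stuffle_list q (map word us)))"
    by (simp add: stuffle_list_def)
  then show ?case
    by (rule keys_stuffle) (use Cons.IH in \<open>auto simp: keys_word\<close>)
qed

lemma finite_lists_bounded:
  fixes f :: "'a \<Rightarrow> nat"
  assumes pos: "\<And>x. x \<in> A \<Longrightarrow> 1 \<le> f x" and fin: "finite {x \<in> A. f x \<le> n}"
  shows "finite {xs. set xs \<subseteq> A \<and> (\<Sum>x\<leftarrow>xs. f x) \<le> n}"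
proof -
  have len: "length xs \<le> (\<Sum>x\<leftarrow>xs. f x)" if "set xs \<subseteq> A" for xs
    using that
  proof (induction xs)
    case (Cons x xs)
    then show ?case using pos[of x] by simp
  qed simp
  have mem: "f x \<le> (\<Sum>x\<leftarrow>xs. f x)" if "x \<in> set xs" for x xs
    using that by (intro member_le_sum_list) auto
  have "{xs. set xs \<subseteq> A \<and> (\<Sum>x\<leftarrow>xs. f x) \<le> n} \<subseteq>
      {xs. set xs \<subseteq> {x \<in> A. f x \<le> n} \<and> length xs \<le> n}"
    using len mem by (fastforce intro: order_trans)
  then show ?thesis
    by (rule finite_subset) (rule finite_lists_length_le[OF fin])
qed

lemma finite_words_weight: "finite {w. weight w \<le> n}"
proof -
  have "inj index" by (simp add: inj_def index_inject)
  then have "finite (index -` {..n})" by (simp add: finite_vimageI)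
  then have "finite {a \<in> UNIV. index a \<le> n}" by (simp add: vimage_def)
  from finite_lists_bounded[OF _ this] show ?thesis
    using index_pos by (simp add: weight_def)
qed

lemma finite_tuples_weight: "finite {us. set us \<subseteq> Yplus \<and> (\<Sum>u\<leftarrow>us. weight u) \<le> n}"
  using finite_words_weight by (intro finite_lists_bounded weight_Yplus) simp_all

lemma length_tuple_le: "set us \<subseteq> Yplus \<Longrightarrow> length us \<le> (\<Sum>u\<leftarrow>us. weight u)"
proof (induction us)
  case (Cons u us)
  then show ?case using weight_Yplus[of u] by simp
qed simp

lemma fsum_neutral: "(\<And>i. i \<in> A \<Longrightarrow> f i = 0) \<Longrightarrow> fsum A f = 0"
proof -
  assume "\<And>i. i \<in> A \<Longrightarrow> f i = 0"
  then have "(\<lambda>i. f i when i \<in> A) = (\<lambda>_. 0)" by (auto simp: when_def)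
  then show ?thesis unfolding fsum_def by (simp only: Sum_any.neutral)
qed

lemma weight_pairing_stuffle:
  "pairing (word w) (stuffle_list q (map word us)) \<noteq> 0 \<Longrightarrow> (\<Sum>u\<leftarrow>us. weight u) = weight w"
  using weight_stuffle_list[of w q us] by (simp add: pairing_word in_keys_iff)

lemma weight_pairing_concat:
  assumes "pairing (word w) (prod_list (map word us)) \<noteq> (0 :: 'k::rat_algebra_1)"
  shows "(\<Sum>u\<leftarrow>us. weight u) = weight w"
proof -
  have "(\<Sum>u\<leftarrow>us. weight u) = weight (concat us)" by (induction us) simp_all
  moreover have "concat us = w"
    using assms by (simp add: pairing_word prod_list_word lookup_word when_def split: if_splits)
  ultimately show ?thesis by simp
qed

text \<open>The inner and outer sums in \<open>pi1\<close>, \<open>pi1_check\<close> and the expansion of a word.\<close>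

lemma finite_support_tuples:
  assumes "\<And>us. c us \<noteq> 0 \<Longrightarrow> (\<Sum>u\<leftarrow>us. weight u) = weight w"
  shows "finite {us. (smult (c us) (P us) when us \<in> tuples k) \<noteq> 0}"
proof (rule finite_subset[OF _ finite_tuples_weight[of "weight w"]])
  show "{us. (smult (c us) (P us) when us \<in> tuples k) \<noteq> 0} \<subseteq>
      {us. set us \<subseteq> Yplus \<and> (\<Sum>u\<leftarrow>us. weight u) \<le> weight w}"
  proof (intro subsetI CollectI)
    fix us assume "us \<in> {us. (smult (c us) (P us) when us \<in> tuples k) \<noteq> 0}"
    then have "us \<in> tuples k" and "c us \<noteq> 0" by (auto simp: when_def split: if_splits)
    then show "set us \<subseteq> Yplus \<and> (\<Sum>u\<leftarrow>us. weight u) \<le> weight w"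
      using assms[of us] by (simp add: tuples_def)
  qed
qed

lemma finite_support_lengths:
  assumes "\<And>us. c us \<noteq> 0 \<Longrightarrow> (\<Sum>u\<leftarrow>us. weight u) = weight w"
  shows "finite {k. (smult (d k) (fsum (tuples k) (\<lambda>us. smult (c us) (P us))) when k \<in> A) \<noteq> 0}"
proof (rule finite_subset)
  have "fsum (tuples k) (\<lambda>us. smult (c us) (P us)) = 0" if "k > weight w" for k
  proof (rule fsum_neutral)
    fix us assume "us \<in> tuples k"
    then have "k \<le> (\<Sum>u\<leftarrow>us. weight u)" using length_tuple_le[of us] by (auto simp: tuples_def)
    with that assms[of us] have "c us = 0" by force
    then show "smult (c us) (P us) = 0" by simp
  qed
  then show "{k. (smult (d k) (fsum (tuples k) (\<lambda>us. smult (c us) (P us))) when k \<in> A) \<noteq> 0}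
      \<subseteq> {..weight w}"
    by (auto simp: when_def not_less[symmetric] split: if_splits)
qed simp

lemmas finite_support_stuffle =
  finite_support_tuples[OF weight_pairing_stuffle] finite_support_lengths[OF weight_pairing_stuffle]

lemmas finite_support_concat =
  finite_support_tuples[OF weight_pairing_concat] finite_support_lengths[OF weight_pairing_concat]

lemma finite_compositions:
  fixes s :: nat
  shows "finite {ss. length ss = k \<and> (\<forall>s'\<in>set ss. 1 \<le> s') \<and> sum_list ss = s}"
    and "finite {k. (smult (c k) (\<Sum>ss | length ss = k \<and> (\<forall>s'\<in>set ss. 1 \<le> s') \<and> sum_list ss = s. P ss)
      when k \<in> A) \<noteq> 0}"
proof -
  have len: "length ss \<le> sum_list ss" if "\<forall>s'\<in>set ss. 1 \<le> s'" for ss :: "nat list"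
    using that by (induction ss) auto
  have "finite {ss. set ss \<subseteq> {..s} \<and> length ss \<le> s}"
    by (rule finite_lists_length_le) simp
  then show "finite {ss. length ss = k \<and> (\<forall>s'\<in>set ss. 1 \<le> s') \<and> sum_list ss = s}"
    by (rule rev_finite_subset) (use len member_le_sum_list in auto)
  let ?C = "\<lambda>k. {ss. length ss = k \<and> (\<forall>s'\<in>set ss. 1 \<le> s') \<and> sum_list ss = s}"
  have "?C k = {}" if "s < k" for k
    using len that by force
  then have "sum P (?C k) = 0" if "s < k" for k
    using that by (simp only: sum.empty)
  then have "(smult (c k) (sum P (?C k)) when k \<in> A) = 0" if "s < k" for k
    using that by (simp only: smult_zero_right when_def if_cancel)
  then have "{k. (smult (c k) (sum P (?C k)) when k \<in> A) \<noteq> 0} \<subseteq> {..s}"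
    unfolding subset_iff mem_Collect_eq atMost_iff by (meson not_le)
  then show "finite {k. (smult (c k) (sum P (?C k)) when k \<in> A) \<noteq> 0}"
    by (rule finite_subset) simp
qed

text \<open>The product of series and the logarithm.\<close>

lemma ts_mult_term_weight:
  assumes "tensor (stuffle q (word u\<^sub>1) (word u\<^sub>2)) (word v\<^sub>1 * word v\<^sub>2) u v \<noteq> (0 :: 'k::rat_algebra_1)"
  shows "weight u = weight u\<^sub>1 + weight u\<^sub>2" "weight v = weight v\<^sub>1 + weight v\<^sub>2"
proof -
  have "u \<in> Poly_Mapping.keys (stuffle q (word u\<^sub>1) (word u\<^sub>2))"
    using assms by (auto simp: tensor_def in_keys_iff)
  then show "weight u = weight u\<^sub>1 + weight u\<^sub>2"
    by (rule keys_stuffle) (auto simp: keys_word)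
  have "v\<^sub>1 @ v\<^sub>2 = v"
    using assms by (auto simp: tensor_def word_mult lookup_word when_def split: if_splits)
  then show "weight v = weight v\<^sub>1 + weight v\<^sub>2" by auto
qed

lemma finite_support_ts_mult:
  fixes S T :: "'k::rat_algebra_1 tensor_series"
  shows "finite {x. (case x of ((u\<^sub>1, v\<^sub>1), (u\<^sub>2, v\<^sub>2)) \<Rightarrow> S u\<^sub>1 v\<^sub>1 * T u\<^sub>2 v\<^sub>2 *
    tensor (stuffle q (word u\<^sub>1) (word u\<^sub>2)) (word v\<^sub>1 * word v\<^sub>2) u v) \<noteq> 0}"
proof (rule finite_subset)
  let ?W = "\<lambda>n. {w. weight w \<le> n}"
  show "finite ((?W (weight u) \<times> ?W (weight v)) \<times> (?W (weight u) \<times> ?W (weight v)))"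
    by (intro finite_cartesian_product finite_words_weight)
  have "weight u\<^sub>1 \<le> weight u \<and> weight u\<^sub>2 \<le> weight u \<and> weight v\<^sub>1 \<le> weight v \<and> weight v\<^sub>2 \<le> weight v"
    if "S u\<^sub>1 v\<^sub>1 * T u\<^sub>2 v\<^sub>2 *
      tensor (stuffle q (word u\<^sub>1) (word u\<^sub>2)) (word v\<^sub>1 * word v\<^sub>2) u v \<noteq> 0" for u\<^sub>1 v\<^sub>1 u\<^sub>2 v\<^sub>2
    using ts_mult_term_weight[of q u\<^sub>1 u\<^sub>2 v\<^sub>1 v\<^sub>2 u v] that by fastforce
  then show "{x. (case x of ((u\<^sub>1, v\<^sub>1), (u\<^sub>2, v\<^sub>2)) \<Rightarrow> S u\<^sub>1 v\<^sub>1 * T u\<^sub>2 v\<^sub>2 *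
    tensor (stuffle q (word u\<^sub>1) (word u\<^sub>2)) (word v\<^sub>1 * word v\<^sub>2) u v) \<noteq> 0} \<subseteq>
    ((?W (weight u) \<times> ?W (weight v)) \<times> (?W (weight u) \<times> ?W (weight v)))"
    by auto
qed

lemma ts_power_eq_0:
  fixes S :: "'k::rat_algebra_1 tensor_series"
  assumes "S [] [] = 0" and "weight u + weight v < k"
  shows "ts_power q S k u v = 0"
  using assms(2)
proof (induction k arbitrary: u v)
  case (Suc k)
  have zero: "S u\<^sub>1 v\<^sub>1 * ts_power q S k u\<^sub>2 v\<^sub>2 *
      tensor (stuffle q (word u\<^sub>1) (word u\<^sub>2)) (word v\<^sub>1 * word v\<^sub>2) u v = 0" for u\<^sub>1 v\<^sub>1 u\<^sub>2 v\<^sub>2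
  proof (rule ccontr)
    assume nz: "\<not> ?thesis"
    then have "tensor (stuffle q (word u\<^sub>1) (word u\<^sub>2)) (word v\<^sub>1 * word v\<^sub>2) u v \<noteq> 0"
      by auto
    note w = ts_mult_term_weight[OF this]
    have "S u\<^sub>1 v\<^sub>1 \<noteq> 0" using nz by auto
    then have "u\<^sub>1 \<in> Yplus \<or> v\<^sub>1 \<in> Yplus" using assms(1) by (auto simp: Yplus_def)
    then have "1 \<le> weight u\<^sub>1 + weight v\<^sub>1" using weight_Yplus by fastforce
    then have "weight u\<^sub>2 + weight v\<^sub>2 < k" using w Suc.prems by linarith
    with nz Suc.IH show False by auto
  qed
  have "ts_power q S (Suc k) u v = ts_mult q S (ts_power q S k) u v"
    by (simp add: ts_power_def)
  also have "\<dots> = 0"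
    unfolding ts_mult_def by (rule fsum_neutral) (auto simp: zero)
  finally show ?case .
qed simp

lemma finite_support_ts_log:
  fixes S :: "'k::rat_algebra_1 tensor_series"
  assumes "S [] [] = 1"
  shows "finite {k. (rat_scalar ((- 1) ^ (k - 1) / of_nat k) *
    ts_power q (\<lambda>u v. S u v - ts_one u v) k u v when k \<in> {1..}) \<noteq> 0}"
proof (rule finite_subset)
  have "ts_power q (\<lambda>u v. S u v - ts_one u v) k u v = 0" if "weight u + weight v < k" for k
    by (rule ts_power_eq_0[OF _ that])
      (simp add: assms ts_one_def tensor_def one_eq_word lookup_word)
  then show "{k. (rat_scalar ((- 1) ^ (k - 1) / of_nat k) *
      ts_power q (\<lambda>u v. S u v - ts_one u v) k u v when k \<in> {1..}) \<noteq> 0} \<subseteq> {..weight u + weight v}"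
    by (auto simp: when_def not_less[symmetric] split: if_splits)
qed simp

lemma finite_support_tensor:
  "finite {w. (tensor (word w) (P w) u v when w \<in> A) \<noteq> (0 :: 'k::rat_algebra_1)}"
  "finite {w. (tensor (P w) (word w) u v when w \<in> A) \<noteq> (0 :: 'k::rat_algebra_1)}"
  by (rule finite_subset[of _ "{u}"] finite_subset[of _ "{v}"];
      auto simp: tensor_def lookup_word when_def split: if_splits)+

lemma diagonal_eq: "diagonal u v = (1 when u = v)"
proof -
  have "diagonal u v = Sum_any (\<lambda>w. 1 when w = u \<and> w = v)"
    unfolding diagonal_def ts_sum_def fsum_def
    by (rule arg_cong[where f = Sum_any]) (auto simp: tensor_def lookup_word when_def fun_eq_iff)
  also have "\<dots> = (\<Sum>w\<in>{u}. 1 when w = u \<and> w = v)"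
    by (rule Sum_any.expand_superset) (auto simp: when_def split: if_splits)
  finally show ?thesis by (auto simp: when_def)
qed

end

theory Submission
  imports Defs "HOL-Computational_Algebra.Formal_Power_Series"
begin

text \<open>
  The coefficient of \<open>u \<otimes> v\<close> in \<open>(\<D>\<^sub>Y - 1)\<^sup>k\<close> is the sum of \<open>\<langle>u | u\<^sub>1 \<star> \<dots> \<star> u\<^sub>k\<rangle>\<close> over the factorizations
  \<open>v = u\<^sub>1 \<dots> u\<^sub>k\<close> into nonempty words. Reading the logarithm by its left or by its right factor gives the two
  formulas of (1), and hence the duality \<open>\<langle>\<pi>\<^sub>1(u) | v\<rangle> = \<langle>\<pi>\<^sub>1\<^sup>\<or>(v) | u\<rangle>\<close>. Since \<open>\<star>\<close> is associative, formal
  power series in one variable act on the convolution powers of \<open>\<D>\<^sub>Y - 1\<close>, so \<open>exp(log(1 + x)) = 1 + x\<close>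
  gives the second expansion in (2). Duality and multilinearity turn it into the first.
\<close>

section \<open>The stuffle algebra\<close>

text \<open>Deconcatenation. It is polymorphic because both words and factorizations, which are
  lists of words, get cut.\<close>

definition cuts :: "'a list \<Rightarrow> ('a list \<times> 'a list) set" where
  "cuts w = {(a, b). a @ b = w}"

text \<open>Indexing by the cut position is the form that matches the Cauchy product of power
  series.\<close>

lemma sum_cuts: "(\<Sum>(a, b)\<in>cuts w. F a b) = (\<Sum>i = 0..length w. F (take i w) (drop i w))"
  by (rule sum.reindex_bij_witness[where i = "\<lambda>i. (take i w, drop i w)" and j = "\<lambda>(a, b). length a"])
    (auto simp: cuts_def)

lemma finite_cuts [simp]: "finite (cuts w)"
proof -
  have "cuts w \<subseteq> (\<lambda>i. (take i w, drop i w)) ` {0..length w}"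
  proof
    fix x assume "x \<in> cuts w"
    then have "x = (take (length (fst x)) w, drop (length (fst x)) w)" "length (fst x) \<le> length w"
      by (auto simp: cuts_def)
    then show "x \<in> (\<lambda>i. (take i w, drop i w)) ` {0..length w}" by auto
  qed
  then show ?thesis by (rule finite_subset) simp
qed

lemma lookup_times:
  fixes P Q :: "'k::rat_algebra_1 ncpoly"
  shows "Poly_Mapping.lookup (P * Q) w =
    (\<Sum>(a, b)\<in>cuts w. Poly_Mapping.lookup P a * Poly_Mapping.lookup Q b)"
proof -
  have "Poly_Mapping.lookup (P * Q) w =
      Sum_any (\<lambda>(a, b). Poly_Mapping.lookup P a * Poly_Mapping.lookup Q b when w = a @ b)"
    by (simp add: times_poly_mapping.rep_eq prod_fun_unfold_prod plus_list_def)
  also have "\<dots> = (\<Sum>(a, b)\<in>cuts w. Poly_Mapping.lookup P a * Poly_Mapping.lookup Q b when w = a @ b)"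
    by (rule Sum_any.expand_superset[OF finite_cuts]) (auto simp: cuts_def when_def split: if_splits)
  also have "\<dots> = (\<Sum>(a, b)\<in>cuts w. Poly_Mapping.lookup P a * Poly_Mapping.lookup Q b)"
    by (rule sum.cong) (auto simp: cuts_def)
  finally show ?thesis .
qed

section \<open>Linear operations on noncommutative polynomials\<close>

lemma smult_add: "smult c (P + Q) = smult c P + smult c Q"
  by (rule poly_mapping_eqI) (simp add: lookup_smult lookup_add algebra_simps)

lemma smult_add_left: "smult (c + d) P = smult c P + smult d P"
  by (rule poly_mapping_eqI) (simp add: lookup_smult lookup_add algebra_simps)

lemma smult_smult: "smult c (smult d P) = smult (c * d) P"
  by (rule poly_mapping_eqI) (simp add: lookup_smult algebra_simps)

lemma smult_1 [simp]: "smult 1 P = P"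
  by (rule poly_mapping_eqI) (simp add: lookup_smult)

lemma smult_sum: "smult c (\<Sum>i\<in>A. f i) = (\<Sum>i\<in>A. smult c (f i))"
  by (induction A rule: infinite_finite_induct) (simp_all add: smult_add)

lemma smult_sum_left: "smult (\<Sum>i\<in>A. f i) P = (\<Sum>i\<in>A. smult (f i) P)"
  by (induction A rule: infinite_finite_induct) (simp_all add: smult_add_left)

lemma times_smult: "P * smult c Q = smult c (P * Q)"
  by (rule poly_mapping_eqI)
    (auto simp: lookup_smult lookup_times sum_distrib_left intro!: sum.cong)

lemma poly_as_sum:
  assumes "finite A" "Poly_Mapping.keys P \<subseteq> A"
  shows "P = (\<Sum>u\<in>A. smult (Poly_Mapping.lookup P u) (word u))"
  by (rule poly_mapping_eqI)
    (use assms in \<open>auto simp: lookup_sum lookup_smult lookup_word when_def in_keys_iff if_distrib cong: if_cong\<close>)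

text \<open>Words span the polynomials, so a property stable under linear operations needs checking
  on words only. The multilinear identities below are reduced to words in this way.\<close>

lemma ncpoly_induct [case_names zero add smult word]:
  assumes "R 0" "\<And>P Q. R P \<Longrightarrow> R Q \<Longrightarrow> R (P + Q)" "\<And>c P. R P \<Longrightarrow> R (smult c P)"
    "\<And>u. R (word u)"
  shows "R P"
proof -
  have "R (\<Sum>u\<in>A. smult (Poly_Mapping.lookup P u) (word u))" for A
    by (induction A rule: infinite_finite_induct) (auto intro: assms)
  then show ?thesis by (subst poly_as_sum[OF finite_keys order_refl])
qed

text \<open>The definition sums over exact supports, which may shrink under addition or scaling. A
  common finite superset lets bilinearity be proved term by term.\<close>

lemma stuffle_superset:
  assumes "finite A" "Poly_Mapping.keys P \<subseteq> A" "finite B" "Poly_Mapping.keys Q \<subseteq> B"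
  shows "stuffle q P Q = (\<Sum>u\<in>A. \<Sum>v\<in>B.
    smult (Poly_Mapping.lookup P u * Poly_Mapping.lookup Q v) (stuffle_words q u v))"
proof -
  have "stuffle q P Q = (\<Sum>u\<in>Poly_Mapping.keys P. \<Sum>v\<in>B.
      smult (Poly_Mapping.lookup P u * Poly_Mapping.lookup Q v) (stuffle_words q u v))"
    unfolding stuffle_def
    by (intro sum.cong refl sum.mono_neutral_left assms) (auto simp: in_keys_iff)
  also have "\<dots> = (\<Sum>u\<in>A. \<Sum>v\<in>B.
      smult (Poly_Mapping.lookup P u * Poly_Mapping.lookup Q v) (stuffle_words q u v))"
    by (intro sum.mono_neutral_left assms) (auto simp: in_keys_iff)
  finally show ?thesis .
qed

lemma stuffle_word [simp]: "stuffle q (word u) (word v) = stuffle_words q u v"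
  by (simp add: stuffle_def keys_word lookup_word)

lemma stuffle_0 [simp]: "stuffle q 0 Q = 0" "stuffle q P 0 = 0"
  by (simp_all add: stuffle_def)

lemma stuffle_add_left: "stuffle q (P + P') Q = stuffle q P Q + stuffle q P' Q"
proof -
  let ?A = "Poly_Mapping.keys P \<union> Poly_Mapping.keys P'"
  show ?thesis
    by (subst (1 2 3) stuffle_superset[where A = ?A and B = "Poly_Mapping.keys Q"])
      (use Poly_Mapping.keys_add[of P P'] in
        \<open>auto simp: lookup_add distrib_right smult_add_left sum.distrib\<close>)
qed

lemma stuffle_add_right: "stuffle q P (Q + Q') = stuffle q P Q + stuffle q P Q'"
proof -
  let ?B = "Poly_Mapping.keys Q \<union> Poly_Mapping.keys Q'"
  show ?thesis
    by (subst (1 2 3) stuffle_superset[where B = ?B and A = "Poly_Mapping.keys P"])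
      (use Poly_Mapping.keys_add[of Q Q'] in
        \<open>auto simp: lookup_add distrib_left smult_add_left sum.distrib\<close>)
qed

lemma stuffle_smult_left: "stuffle q (smult c P) Q = smult c (stuffle q P Q)"
  by (subst (1 2) stuffle_superset[where A = "Poly_Mapping.keys P" and B = "Poly_Mapping.keys Q"])
    (use keys_smult[of c P] in \<open>auto simp: lookup_smult smult_sum smult_smult mult.assoc\<close>)

lemma stuffle_smult_right: "stuffle q P (smult c Q) = smult c (stuffle q P Q)"
  by (subst (1 2) stuffle_superset[where A = "Poly_Mapping.keys P" and B = "Poly_Mapping.keys Q"])
    (use keys_smult[of c Q] in \<open>auto simp: lookup_smult smult_sum smult_smult mult.left_commute\<close>)

lemma stuffle_sum_left: "stuffle q (\<Sum>i\<in>A. f i) Q = (\<Sum>i\<in>A. stuffle q (f i) Q)"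
  by (induction A rule: infinite_finite_induct) (simp_all add: stuffle_add_left)

lemma stuffle_sum_right: "stuffle q P (\<Sum>i\<in>A. f i) = (\<Sum>i\<in>A. stuffle q P (f i))"
  by (induction A rule: infinite_finite_induct) (simp_all add: stuffle_add_right)

lemmas stuffle_linear = stuffle_add_left stuffle_add_right stuffle_smult_left stuffle_smult_right

lemma stuffle_one_right [simp]: "stuffle q P 1 = P"
  by (induction P rule: ncpoly_induct) (simp_all add: one_eq_word stuffle_linear)

lemma stuffle_words_Nil_left [simp]: "stuffle_words q [] v = word v"
  by (cases v) simp_all

lemma stuffle_one_left [simp]: "stuffle q 1 P = P"
  by (induction P rule: ncpoly_induct) (simp_all add: one_eq_word stuffle_linear)

section \<open>Associativity of the stuffle product\<close>

definition letter_add :: "letter \<Rightarrow> letter \<Rightarrow> letter" where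
  "letter_add a b = y (index a + index b)"

lemma letter_add_assoc: "letter_add (letter_add a b) c = letter_add a (letter_add b c)"
proof -
  have "index (y (index a + index b)) = index a + index b" "index (y (index b + index c)) = index b + index c"
    using index_pos[of a] index_pos[of b] by (simp_all add: y_inverse)
  then show ?thesis by (simp add: letter_add_def add.assoc)
qed

text \<open>The recursion on words extends bilinearly to polynomial tails. This form is needed
  because one unfolding of a nested product already leaves polynomials, not words, behind the
  leading letters.\<close>

lemma stuffle_letter_mult:
  "stuffle q (word [a] * P) (word [b] * Q) =
     word [a] * stuffle q P (word [b] * Q) + word [b] * stuffle q (word [a] * P) Q +
     smult q (word [letter_add a b] * stuffle q P Q)"
proof (induction P rule: ncpoly_induct)
  case (word u)
  show ?case
  proof (induction Q rule: ncpoly_induct)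
    case (word v)
    show ?case by (simp add: word_mult letter_add_def)
  qed (simp_all add: stuffle_linear distrib_left distrib_right times_smult smult_add
      smult_smult mult.commute add_ac)
qed (simp_all add: stuffle_linear distrib_left distrib_right times_smult smult_add
      smult_smult mult.commute add_ac)

text \<open>Each bracketing of three nonempty words expands into seven terms, one for each nonempty
  subset of the leading letters \<open>a\<close>, \<open>b\<close>, \<open>c\<close>: the letters of
  the subset are removed and their sum is put in front. The terms agree pairwise by induction on the
  total length.\<close>

lemma stuffle_words_assoc:
  "stuffle q (stuffle_words q u v) (word w) = stuffle q (word u) (stuffle_words q v w)"
proof (induction "length u + length v + length w" arbitrary: u v w rule: less_induct)
  case less
  show ?case
  proof (cases "u = [] \<or> v = [] \<or> w = []")
    case True
    then show ?thesis by (auto simp flip: one_eq_word)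
  next
    case False
    then obtain a u' b v' c w' where [simp]: "u = a # u'" "v = b # v'" "w = c # w'"
      by (metis list.exhaust)
    have ww: "word (d # x) = word [d] * (word x :: 'a ncpoly)" for d x
      by (simp add: word_mult)
    note IH = less[unfolded stuffle_word[symmetric]]
    let ?s = "stuffle q"
    let ?u = "word u' :: 'a ncpoly" and ?v = "word v' :: 'a ncpoly" and ?w = "word w' :: 'a ncpoly"
    let ?A = "word [a] :: 'a ncpoly" and ?B = "word [b] :: 'a ncpoly" and ?C = "word [c] :: 'a ncpoly"
    \<comment> \<open>One induction instance for each nonempty set of removed leading
      letters.\<close>
    have i: "?s (?s ?u (?B*?v)) (?C*?w) = ?s ?u (?s (?B*?v) (?C*?w))"
      "?s (?s ?u (?B*?v)) ?w = ?s ?u (?s (?B*?v) ?w)"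
      "?s (?s (?A*?u) ?v) (?C*?w) = ?s (?A*?u) (?s ?v (?C*?w))"
      "?s (?s (?A*?u) ?v) ?w = ?s (?A*?u) (?s ?v ?w)"
      "?s (?s ?u ?v) (?C*?w) = ?s ?u (?s ?v (?C*?w))"
      "?s (?s ?u ?v) ?w = ?s ?u (?s ?v ?w)"
      "?s (?s (?A*?u) (?B*?v)) ?w = ?s (?A*?u) (?s (?B*?v) ?w)"
      by (simp_all only: word_mult) (rule IH; simp)+
    \<comment> \<open>Merging two letters costs \<open>q\<close> and merging all three costs
      \<open>q * q\<close>. The three summands that begin with \<open>c\<close> recombine, by
      linearity, into one term with the unexpanded product of the first two words.\<close>
    have l: "?s (?s (?A*?u) (?B*?v)) (?C*?w) =
       ?A * ?s (?s ?u (?B*?v)) (?C*?w) + ?B * ?s (?s (?A*?u) ?v) (?C*?w)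
       + smult q (word [letter_add a b] * ?s (?s ?u ?v) (?C*?w))
       + ?C * ?s (?s (?A*?u) (?B*?v)) ?w
       + smult q (word [letter_add a c] * ?s (?s ?u (?B*?v)) ?w)
       + smult q (word [letter_add b c] * ?s (?s (?A*?u) ?v) ?w)
       + smult (q*q) (word [letter_add a (letter_add b c)] * ?s (?s ?u ?v) ?w)"
      by (simp add: stuffle_letter_mult[of q a ?u b ?v] stuffle_linear stuffle_letter_mult[of q _ _ c ?w] letter_add_assoc
        distrib_left times_smult smult_add smult_smult add_ac)
    have r: "?s (?A*?u) (?s (?B*?v) (?C*?w)) =
       ?A * ?s ?u (?s (?B*?v) (?C*?w)) + ?B * ?s (?A*?u) (?s ?v (?C*?w))
       + smult q (word [letter_add a b] * ?s ?u (?s ?v (?C*?w)))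
       + ?C * ?s (?A*?u) (?s (?B*?v) ?w)
       + smult q (word [letter_add a c] * ?s ?u (?s (?B*?v) ?w))
       + smult q (word [letter_add b c] * ?s (?A*?u) (?s ?v ?w))
       + smult (q*q) (word [letter_add a (letter_add b c)] * ?s ?u (?s ?v ?w))"
      by (simp add: stuffle_letter_mult[of q b ?v c ?w] stuffle_linear stuffle_letter_mult[of q a ?u]
        distrib_left times_smult smult_add smult_smult add_ac)
    have "?s (?s (?A*?u) (?B*?v)) (?C*?w) = ?s (?A*?u) (?s (?B*?v) (?C*?w))"
      unfolding l r by (simp only: i)
    then show ?thesis by (simp only: word_mult append.simps stuffle_word \<open>u = a # u'\<close> \<open>v = b # v'\<close> \<open>w = c # w'\<close>)
  qed
qed

lemma stuffle_assoc: "stuffle q (stuffle q P Q) R = stuffle q P (stuffle q Q R)"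
proof (induction P rule: ncpoly_induct)
  case (word u)
  show ?case
  proof (induction Q rule: ncpoly_induct)
    case (word v)
    show ?case
      by (induction R rule: ncpoly_induct) (simp_all add: stuffle_linear stuffle_words_assoc)
  qed (simp_all add: stuffle_linear)
qed (simp_all add: stuffle_linear)

lemma stuffle_list_Nil [simp]: "stuffle_list q [] = 1"
  by (simp add: stuffle_list_def)

lemma stuffle_list_Cons [simp]: "stuffle_list q (P # Ps) = stuffle q P (stuffle_list q Ps)"
  by (simp add: stuffle_list_def)

lemma stuffle_list_append: "stuffle_list q (Ps @ Qs) = stuffle q (stuffle_list q Ps) (stuffle_list q Qs)"
  by (induction Ps) (simp_all add: stuffle_assoc)

section \<open>The ring homomorphism from the rationals to the coefficients\<close>

lemma rat_scalar_add: "rat_scalar (r + s) = rat_scalar r + rat_scalar s"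
  by (simp add: rat_scalar_def scaleQ_add_left)

lemma rat_scalar_0 [simp]: "rat_scalar 0 = 0"
  using rat_scalar_add[of 0 0] by simp

lemma rat_scalar_1 [simp]: "rat_scalar 1 = 1"
  by (simp add: rat_scalar_def scaleQ_one)

lemma rat_scalar_mult: "rat_scalar (r * s) = rat_scalar r * rat_scalar s"
  by (simp add: rat_scalar_def scaleQ_mult_left scaleQ_scaleQ)

lemma rat_scalar_sum: "rat_scalar (\<Sum>i\<in>A. f i) = (\<Sum>i\<in>A. rat_scalar (f i))"
  by (induction A rule: infinite_finite_induct) (simp_all add: rat_scalar_add)

section \<open>Factorizations of a word\<close>

lemma fsum_eq_sum:
  assumes "finite B" "B \<subseteq> A" "\<And>i. i \<in> A - B \<Longrightarrow> f i = 0"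
  shows "fsum A f = sum f B"
proof -
  have "fsum A f = (\<Sum>i\<in>B. f i when i \<in> A)"
    unfolding fsum_def using assms(3)
    by (intro Sum_any.expand_superset[OF assms(1)]) (auto simp: when_def split: if_splits)
  also have "\<dots> = sum f B"
    using assms(2) by (intro sum.cong) (auto simp: when_def)
  finally show ?thesis .
qed

lemma fsum_tuples:
  assumes "finite U" "\<And>us. us \<in> U \<Longrightarrow> set us \<subseteq> Yplus"
    and "\<And>us. set us \<subseteq> Yplus \<Longrightarrow> us \<notin> U \<Longrightarrow> c us = 0"
  shows "fsum (tuples k) (\<lambda>us. smult (c us) (G us)) = (\<Sum>us | us \<in> U \<and> length us = k. smult (c us) (G us))"
  by (rule fsum_eq_sum) (use assms in \<open>auto simp: tuples_def\<close>)

text \<open>Replaces the sum over lengths and tuples by a single finite sum over any finite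
  \<open>U\<close> that carries all nonzero coefficients. Below, \<open>U\<close> consists of the
  factorizations of a word when the coefficient comes from concatenation, and of tuples bounded in
  weight or length when it comes from \<star>.\<close>

lemma fsum_fsum_tuples:
  assumes U: "finite U" "\<And>us. us \<in> U \<Longrightarrow> set us \<subseteq> Yplus"
    and c: "\<And>us. set us \<subseteq> Yplus \<Longrightarrow> us \<notin> U \<Longrightarrow> c us = 0"
  shows "fsum K (\<lambda>k. smult (d k) (fsum (tuples k) (\<lambda>us. smult (c us) (G us)))) =
    (\<Sum>us | us \<in> U \<and> length us \<in> K. smult (d (length us) * c us) (G us))"
proof -
  let ?T = "\<lambda>k. {us. us \<in> U \<and> length us = k}"
  have "fsum K (\<lambda>k. smult (d k) (fsum (tuples k) (\<lambda>us. smult (c us) (G us)))) =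
      fsum K (\<lambda>k. smult (d k) (\<Sum>us\<in>?T k. smult (c us) (G us)))"
    by (subst fsum_tuples[OF U c]) auto
  also have "\<dots> = (\<Sum>k\<in>length ` U \<inter> K. smult (d k) (\<Sum>us\<in>?T k. smult (c us) (G us)))"
  proof (rule fsum_eq_sum)
    fix k assume "k \<in> K - length ` U \<inter> K"
    then have "?T k = {}" by auto
    then show "smult (d k) (\<Sum>us\<in>?T k. smult (c us) (G us)) = 0" by (simp only: sum.empty smult_zero_right)
  qed (use U in auto)
  also have "\<dots> = (\<Sum>k\<in>length ` U \<inter> K. \<Sum>us\<in>?T k. smult (d (length us) * c us) (G us))"
    by (simp add: smult_sum smult_smult)
  also have "\<dots> = (\<Sum>k\<in>length ` U \<inter> K. \<Sum>us | us \<in> {us. us \<in> U \<and> length us \<in> K} \<and> length us = k.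
      smult (d (length us) * c us) (G us))"
    by (intro sum.cong) auto
  also have "\<dots> = (\<Sum>us | us \<in> U \<and> length us \<in> K. smult (d (length us) * c us) (G us))"
    by (rule sum.group) (use U in auto)
  finally show ?thesis .
qed

text \<open>Excluding empty factors keeps the set finite and leaves the empty word with exactly one
  factorization, the empty one.\<close>

definition splits :: "word \<Rightarrow> word list set" where
  "splits w = {us. set us \<subseteq> Yplus \<and> concat us = w}"

lemma length_le_length_concat: "set us \<subseteq> Yplus \<Longrightarrow> length us \<le> length (concat us)"
proof (induction us)
  case (Cons u us)
  then show ?case by (cases u) (auto simp: Yplus_def)
qed simp

lemma length_splits_le: "us \<in> splits w \<Longrightarrow> length us \<le> length w"
  using length_le_length_concat by (auto simp: splits_def)

lemma weight_concat: "weight (concat us) = (\<Sum>u\<leftarrow>us. weight u)"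
  by (induction us) simp_all

lemma finite_splits [simp]: "finite (splits w)"
  by (rule finite_subset[OF _ finite_tuples_weight[of "weight w"]])
    (auto simp: splits_def weight_concat)

lemma splits_Nil [simp]: "splits [] = {[]}"
proof -
  have "us = []" if "set us \<subseteq> Yplus" "concat us = []" for us
    using that by (cases us) (auto simp: Yplus_def)
  then show ?thesis by (auto simp: splits_def)
qed

lemma splits_length_1: "{us \<in> splits w. length us = 1} = (if w = [] then {} else {[w]})"
  by (auto simp: splits_def length_Suc_conv Yplus_def)

text \<open>Choose the first factor \<open>a\<close>. Cuts with \<open>a = []\<close> are kept with
  value 0, so that the sum has the shape of a convolution over all cuts.\<close>

lemma sum_splits_Suc:
  "(\<Sum>us | us \<in> splits w \<and> length us = Suc k. F us) =
   (\<Sum>(a, b)\<in>cuts w. if a = [] then 0 else (\<Sum>us | us \<in> splits b \<and> length us = k. F (a # us)))"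
proof -
  let ?C = "{(a, b) \<in> cuts w. a \<noteq> []}"
  have fin: "finite ?C" by (rule finite_subset[OF _ finite_cuts[of w]]) auto
  have "(\<Sum>(a, b)\<in>cuts w. if a = [] then 0 else (\<Sum>us | us \<in> splits b \<and> length us = k. F (a # us))) =
      (\<Sum>(a, b)\<in>?C. \<Sum>us | us \<in> splits b \<and> length us = k. F (a # us))"
    by (rule sum.mono_neutral_cong_right) (auto split: if_splits)
  also have "\<dots> = (\<Sum>((a, b), us)\<in>(SIGMA p:?C. {us. us \<in> splits (snd p) \<and> length us = k}). F (a # us))"
    by (subst sum.Sigma[symmetric]) (auto simp: fin intro!: sum.cong)
  also have "\<dots> = (\<Sum>us | us \<in> splits w \<and> length us = Suc k. F us)"
    by (rule sum.reindex_bij_witness[where j = "\<lambda>((a, b), us). a # us"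
          and i = "\<lambda>us. ((hd us, concat (tl us)), tl us)"])
      (auto simp: splits_def cuts_def Yplus_def length_Suc_conv)
  finally show ?thesis by simp
qed

text \<open>Cutting a word and then factoring both pieces is the same as factoring the word and then
  cutting the list of factors.\<close>

lemma sum_splits_append:
  "(\<Sum>(a, b)\<in>cuts w. \<Sum>us\<in>splits a. \<Sum>vs\<in>splits b. F us vs) =
   (\<Sum>ws\<in>splits w. \<Sum>(us, vs)\<in>cuts ws. F us vs)"
proof -
  have "(\<Sum>(a, b)\<in>cuts w. \<Sum>us\<in>splits a. \<Sum>vs\<in>splits b. F us vs) =
      (\<Sum>(p, us, vs)\<in>(SIGMA p:cuts w. splits (fst p) \<times> splits (snd p)). F us vs)"
    by (subst sum.Sigma[symmetric]) (auto simp: sum.cartesian_product intro!: sum.cong)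
  also have "\<dots> = (\<Sum>(ws, us, vs)\<in>(SIGMA ws:splits w. cuts ws). F us vs)"
    by (rule sum.reindex_bij_witness[where j = "\<lambda>(p, us, vs). (us @ vs, us, vs)"
          and i = "\<lambda>(ws, us, vs). ((concat us, concat vs), us, vs)"])
      (auto simp: splits_def cuts_def)
  also have "\<dots> = (\<Sum>ws\<in>splits w. \<Sum>(us, vs)\<in>cuts ws. F us vs)"
    by (subst sum.Sigma[symmetric]) auto
  finally show ?thesis .
qed

section \<open>Power series in the convolution algebra\<close>

abbreviation (input) stuffle_words_list :: "'k \<Rightarrow> word list \<Rightarrow> 'k::rat_algebra_1 ncpoly" where
  "stuffle_words_list q us \<equiv> stuffle_list q (map word us)"

text \<open>
  The coefficient of \<open>w\<close>, taken in the right factor, of the series \<open>f(\<D>\<^sub>Y - 1)\<close>. Summing over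
  factorizations of \<open>w\<close> into nonempty words makes it a finite sum even if \<open>f\<close> has a constant term.
\<close>

definition conv_series :: "'k \<Rightarrow> rat fps \<Rightarrow> word \<Rightarrow> 'k::rat_algebra_1 ncpoly" where
  "conv_series q f w = (\<Sum>us\<in>splits w. smult (rat_scalar (fps_nth f (length us))) (stuffle_words_list q us))"

text \<open>Evaluation at \<D> - 1 is multiplicative: a pair of factorizations of the two pieces is
  a cut of a factorization of \<open>w\<close>, and by associativity its \<star> product depends
  only on the joined list.\<close>

lemma conv_series_mult:
  "(\<Sum>(a, b)\<in>cuts w. stuffle q (conv_series q f a) (conv_series q g b)) = conv_series q (f * g) w"
proof -
  let ?c = "\<lambda>f us. rat_scalar (fps_nth f (length us))"
  have "(\<Sum>(a, b)\<in>cuts w. stuffle q (conv_series q f a) (conv_series q g b)) =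
      (\<Sum>(a, b)\<in>cuts w. \<Sum>us\<in>splits a. \<Sum>vs\<in>splits b.
        smult (?c f us * ?c g vs) (stuffle_words_list q (us @ vs)))"
    unfolding conv_series_def
    unfolding stuffle_sum_left
    unfolding stuffle_sum_right
    by (simp add: stuffle_smult_left stuffle_smult_right smult_smult stuffle_list_append mult.commute
        del: stuffle_list_Cons)
  also have "\<dots> = (\<Sum>ws\<in>splits w. \<Sum>(us, vs)\<in>cuts ws.
        smult (?c f us * ?c g vs) (stuffle_words_list q (us @ vs)))"
    by (rule sum_splits_append)
  \<comment> \<open>All cuts of \<open>ws\<close> share the same \<star> product, so only the
    scalars are summed, and they form the Cauchy coefficient at \<open>length ws\<close>.\<close>
  also have "\<dots> = conv_series q (f * g) w"
    unfolding conv_series_def sum_cuts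
    by (intro sum.cong) (auto simp: fps_mult_nth rat_scalar_sum rat_scalar_mult smult_sum_left intro!: sum.cong)
  finally show ?thesis .
qed

lemma conv_series_1: "conv_series q 1 w = (if w = [] then 1 else 0)"
proof -
  have "conv_series q 1 w = (\<Sum>us\<in>splits w. if us = [] then 1 else 0)"
    unfolding conv_series_def by (intro sum.cong) auto
  also have "\<dots> = (if [] \<in> splits w then 1 else 0)" by simp
  also have "\<dots> = (if w = [] then 1 else 0)" by (auto simp: splits_def)
  finally show ?thesis .
qed

text \<open>Pairing \<open>w\<close> with a concatenation selects exactly the factorizations of
  \<open>w\<close>, each with coefficient 1.\<close>

lemma pi1_check_eq:
  "pi1_check q w = word w + (\<Sum>us | us \<in> splits w \<and> length us \<in> {2..}.
     smult (rat_scalar ((- 1) ^ (length us - 1) / of_nat (length us))) (stuffle_words_list q us))"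
proof -
  have "pi1_check q w = word w + (\<Sum>us | us \<in> splits w \<and> length us \<in> {2..}.
     smult (rat_scalar ((- 1) ^ (length us - 1) / of_nat (length us)) *
      pairing (word w) (prod_list (map word us))) (stuffle_words_list q us))"
    unfolding pi1_check_def
    by (subst fsum_fsum_tuples[where U = "splits w"])
      (auto simp: pairing_word prod_list_word lookup_word, auto simp: splits_def)
  also have "\<dots> = word w + (\<Sum>us | us \<in> splits w \<and> length us \<in> {2..}.
     smult (rat_scalar ((- 1) ^ (length us - 1) / of_nat (length us))) (stuffle_words_list q us))"
    by (intro arg_cong2[where f = "(+)"] refl sum.cong)
      (auto simp: splits_def pairing_word prod_list_word lookup_word)
  finally show ?thesis .
qed

text \<open>\<open>fps_ln 1\<close> is the series of log(1 + x), and the isolated summand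
  \<open>w\<close> is its term of degree 1. The empty word is excluded because there
  \<open>pi1_check\<close> gives 1 while the logarithm gives 0.\<close>

lemma pi1_check_conv_series:
  assumes "w \<noteq> []"
  shows "pi1_check q w = conv_series q (fps_ln 1) w"
proof -
  let ?F = "\<lambda>us. smult (rat_scalar (fps_nth (fps_ln 1) (length us))) (stuffle_words_list q us)"
  have "1 \<le> length us" if "us \<in> splits w" for us
    using assms that by (cases us) (auto simp: splits_def)
  then have *: "splits w = {us \<in> splits w. length us = 1} \<union> {us \<in> splits w. length us \<in> {2..}}"
    by (force simp: le_eq_less_or_eq[of 1])
  have "conv_series q (fps_ln 1) w =
      sum ?F {us \<in> splits w. length us = 1} + sum ?F {us \<in> splits w. length us \<in> {2..}}"
    unfolding conv_series_def by (subst *, rule sum.union_disjoint) auto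
  moreover have "sum ?F {us \<in> splits w. length us = 1} = word w"
    unfolding splits_length_1 using assms by (simp add: fps_ln_nth)
  ultimately show ?thesis
    unfolding pi1_check_eq
    by (auto simp: fps_ln_nth intro!: sum.cong)
qed

text \<open>Both sides add to the pairing of \<open>u\<close> with \<open>v\<close> the same sum
  over tuples with concatenation \<open>v\<close>, weighted by the coefficient of \<open>u\<close>
  in their \<star> product. Only the finite index sets differ.\<close>

lemma lookup_pi1: "Poly_Mapping.lookup (pi1 q u) v = Poly_Mapping.lookup (pi1_check q v) u"
proof -
  let ?U = "{us. set us \<subseteq> Yplus \<and> (\<Sum>u\<leftarrow>us. weight u) \<le> weight u}"
  let ?d = "\<lambda>us :: word list. rat_scalar ((- 1) ^ (length us - 1) / of_nat (length us)) :: 'a"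
  have supp: "weight u = (\<Sum>u\<leftarrow>us. weight u)" if "Poly_Mapping.lookup (stuffle_words_list q us) u \<noteq> 0" for us
    using that weight_stuffle_list[of u q us] by (simp add: in_keys_iff)
  have "pi1 q u = word u + (\<Sum>us | us \<in> ?U \<and> length us \<in> {2..}.
      smult (?d us * pairing (word u) (stuffle_words_list q us)) (prod_list (map word us)))"
    unfolding pi1_def
    by (subst fsum_fsum_tuples[where U = ?U])
      (use finite_tuples_weight supp in \<open>force simp: pairing_word\<close>)+
  then have "Poly_Mapping.lookup (pi1 q u) v = (1 when u = v) + (\<Sum>us | us \<in> ?U \<and> length us \<in> {2..}.
      ?d us * Poly_Mapping.lookup (stuffle_words_list q us) u * (1 when concat us = v))"
    by (simp add: lookup_add lookup_sum lookup_smult pairing_word prod_list_word lookup_word)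
  \<comment> \<open>The condition \<open>concat us = v\<close> cuts \<open>?U\<close> down to
    factorizations of \<open>v\<close>. A factorization outside \<open>?U\<close> has the wrong
    total weight, so its coefficient vanishes by homogeneity.\<close>
  also have "(\<Sum>us | us \<in> ?U \<and> length us \<in> {2..}.
      ?d us * Poly_Mapping.lookup (stuffle_words_list q us) u * (1 when concat us = v)) =
      (\<Sum>us | us \<in> splits v \<and> length us \<in> {2..}. ?d us * Poly_Mapping.lookup (stuffle_words_list q us) u)"
  proof (rule sum.mono_neutral_cong)
    show "finite {us \<in> splits v. length us \<in> {2..}}"
      by (rule finite_subset[OF _ finite_splits]) auto
    show "?d us * Poly_Mapping.lookup (stuffle_words_list q us) u = 0"
      if "us \<in> {us \<in> splits v. length us \<in> {2..}} - {us \<in> ?U. length us \<in> {2..}}" for us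
      using supp[of us] that by (cases "Poly_Mapping.lookup (stuffle_words_list q us) u = 0") (auto simp: splits_def)
    show "finite {us \<in> ?U. length us \<in> {2..}}"
      using finite_tuples_weight by (rule rev_finite_subset) auto
  qed (use supp in \<open>auto simp: splits_def when_def\<close>)
  also have "(1 when u = v) + \<dots> = Poly_Mapping.lookup (pi1_check q v) u"
    by (simp add: pi1_check_eq lookup_add lookup_sum lookup_smult lookup_word when_def eq_commute[of u])
  finally show ?thesis .
qed

lemma pi1_check_Nil [simp]: "pi1_check q [] = 1"
  by (simp add: pi1_check_eq one_eq_word)

text \<open>These sums are the right-hand coefficients of the k-th power of log \<D>. Each induction
  step splits off the first factor and multiplies once more by the logarithm.\<close>

lemma sum_stuffle_pi1_check:
  "(\<Sum>us | us \<in> splits w \<and> length us = k. stuffle_list q (map (pi1_check q) us)) =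
   conv_series q (fps_ln 1 ^ k) w"
proof (induction k arbitrary: w)
  case 0
  have "{us. us \<in> splits w \<and> length us = 0} = (if w = [] then {[]} else {})"
    by (auto simp: splits_def)
  then show ?case by (simp add: conv_series_1 del: length_0_conv)
next
  case (Suc k)
  have "(\<Sum>us | us \<in> splits w \<and> length us = Suc k. stuffle_list q (map (pi1_check q) us)) =
      (\<Sum>(a, b)\<in>cuts w. if a = [] then 0 else stuffle q (pi1_check q a) (conv_series q (fps_ln 1 ^ k) b))"
    unfolding sum_splits_Suc by (intro sum.cong refl) (auto simp: Suc.IH[symmetric] stuffle_sum_right)
  \<comment> \<open>The branch \<open>a = []\<close> agrees because log(1 + x) has constant term
    0.\<close>
  also have "\<dots> = (\<Sum>(a, b)\<in>cuts w. stuffle q (conv_series q (fps_ln 1) a) (conv_series q (fps_ln 1 ^ k) b))"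
    by (intro sum.cong refl) (auto simp: pi1_check_conv_series conv_series_def[of q _ "[]"])
  finally show ?case by (simp add: conv_series_mult)
qed

text \<open>The series \<open>fps_ln 1\<close> is the compositional inverse of
  \<open>fps_exp 1 - 1\<close>; it remains to restore the constant term.\<close>

lemma fps_exp_ln: "fps_exp 1 oo fps_ln 1 = (1 + fps_X :: rat fps)"
proof -
  have "(fps_exp 1 - 1) oo fps_ln 1 = (fps_X :: rat fps)"
    using fps_inv_fps_exp_compose(2)[of "1 :: rat"] by (simp add: fps_ln_fps_exp_inv)
  then show ?thesis by (simp add: fps_compose_sub_distrib diff_eq_eq add.commute)
qed

text \<open>The coefficient of exp(log(1 + x)) in degree \<open>n\<close>. Truncation at any
  \<open>N\<close> from \<open>n\<close> on is harmless, since the k-th power of the logarithm has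
  no terms below degree k.\<close>

lemma sum_fact_ln_power:
  assumes "n \<le> N"
  shows "(\<Sum>k\<le>N. 1 / fact k * fps_nth (fps_ln 1 ^ k) n) = (if n \<le> 1 then 1 else (0 :: rat))"
proof -
  have "(\<Sum>k\<le>N. 1 / fact k * fps_nth (fps_ln 1 ^ k) n) = (\<Sum>k=0..n. 1 / fact k * fps_nth (fps_ln 1 ^ k) n :: rat)"
    by (rule sum.mono_neutral_right)
      (use assms startsby_zero_power_prefix[OF fps_ln_0[of "1 :: rat"]] in auto)
  also have "\<dots> = fps_nth (fps_exp 1 oo fps_ln 1) n"
    by (simp add: fps_compose_nth)
  also have "\<dots> = (if n \<le> 1 then 1 else 0)"
    unfolding fps_exp_ln by (cases n) auto
  finally show ?thesis .
qed

lemma sum_splits_group: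
  assumes "length w \<le> N"
  shows "(\<Sum>us\<in>splits w. smult (d (length us)) (G us)) =
    (\<Sum>k\<le>N. smult (d k) (\<Sum>us | us \<in> splits w \<and> length us = k. G us))"
proof -
  have "(\<Sum>us\<in>splits w. smult (d (length us)) (G us)) =
      (\<Sum>k\<le>N. \<Sum>us | us \<in> splits w \<and> length us = k. smult (d (length us)) (G us))"
    by (rule sum.group[symmetric]) (use length_splits_le assms in force)+
  then show ?thesis by (simp add: smult_sum)
qed

lemma exp_pi1_check:
  "word w = (\<Sum>us\<in>splits w. smult (rat_scalar (1 / fact (length us))) (stuffle_list q (map (pi1_check q) us)))"
proof -
  let ?N = "length w"
  have "(\<Sum>us\<in>splits w. smult (rat_scalar (1 / fact (length us))) (stuffle_list q (map (pi1_check q) us))) =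
      (\<Sum>k\<le>?N. smult (rat_scalar (1 / fact k)) (conv_series q (fps_ln 1 ^ k) w))"
    by (subst sum_splits_group[OF order_refl, where d = "\<lambda>n. rat_scalar (1 / fact n)"])
      (simp add: sum_stuffle_pi1_check)
  \<comment> \<open>After exchanging the sums, a factorization is weighted by the coefficient of
    exp(log(1 + x)) at its length, so only lengths 0 and 1 survive.\<close>
  also have "\<dots> = (\<Sum>us\<in>splits w. smult (rat_scalar (\<Sum>k\<le>?N. 1 / fact k * fps_nth (fps_ln 1 ^ k) (length us)))
      (stuffle_words_list q us))"
    unfolding conv_series_def smult_sum smult_smult rat_scalar_sum smult_sum_left
    by (subst sum.swap) (simp flip: rat_scalar_mult)
  also have "\<dots> = (\<Sum>us\<in>splits w. if length us \<le> 1 then stuffle_words_list q us else 0)"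
    by (intro sum.cong refl, subst sum_fact_ln_power) (auto simp: length_splits_le)
  \<comment> \<open>Exactly one factorization has length at most 1: the empty one for the empty
    word, and \<open>[w]\<close> otherwise.\<close>
  also have "\<dots> = (\<Sum>us\<in>{if w = [] then [] else [w]}. stuffle_words_list q us)"
    by (intro sum.mono_neutral_cong_right)
      (auto, auto simp: splits_def Yplus_def le_Suc_eq length_Suc_conv split: if_splits)
  also have "\<dots> = word w" by (simp add: one_eq_word)
  finally show ?thesis by simp
qed

section \<open>Duality between \<open>\<pi>\<^sub>1\<close> and its dual\<close>

text \<open>Expands the left factor over an index set independent of \<open>P\<close>: by
  homogeneity, words heavier than \<open>w\<close> contribute nothing. This independence permits the
  later exchange of sums.\<close>

lemma lookup_stuffle_left:
  assumes "finite A" "{u. weight u \<le> weight w} \<subseteq> A"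
  shows "Poly_Mapping.lookup (stuffle q P Q) w =
    (\<Sum>u\<in>A. Poly_Mapping.lookup P u * Poly_Mapping.lookup (stuffle q (word u) Q) w)"
proof -
  have "Poly_Mapping.lookup (stuffle q P Q) w =
      (\<Sum>u\<in>Poly_Mapping.keys P. Poly_Mapping.lookup P u * Poly_Mapping.lookup (stuffle q (word u) Q) w)"
    by (subst poly_as_sum[OF finite_keys order_refl, of P])
      (simp add: stuffle_sum_left stuffle_smult_left lookup_sum lookup_smult)
  also have "\<dots> = (\<Sum>u\<in>A. Poly_Mapping.lookup P u * Poly_Mapping.lookup (stuffle q (word u) Q) w)"
  proof (rule sum.mono_neutral_cong)
    fix u assume "u \<in> Poly_Mapping.keys P - A"
    then have "\<not> weight u \<le> weight w" using assms(2) by auto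
    then have "w \<notin> Poly_Mapping.keys (stuffle q (word u) Q)"
      by (auto elim!: keys_stuffle simp: keys_word)
    then show "Poly_Mapping.lookup P u * Poly_Mapping.lookup (stuffle q (word u) Q) w = 0"
      by (simp add: in_keys_iff)
  qed (use assms in \<open>auto simp: in_keys_iff\<close>)
  finally show ?thesis .
qed

lemma lookup_stuffle_right:
  assumes "finite A" "{u. weight u \<le> weight w} \<subseteq> A"
  shows "Poly_Mapping.lookup (stuffle q P Q) w =
    (\<Sum>u\<in>A. Poly_Mapping.lookup Q u * Poly_Mapping.lookup (stuffle q P (word u)) w)"
proof -
  have "Poly_Mapping.lookup (stuffle q P Q) w =
      (\<Sum>u\<in>Poly_Mapping.keys Q. Poly_Mapping.lookup Q u * Poly_Mapping.lookup (stuffle q P (word u)) w)"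
    by (subst poly_as_sum[OF finite_keys order_refl, of Q])
      (simp add: stuffle_sum_right stuffle_smult_right lookup_sum lookup_smult)
  also have "\<dots> = (\<Sum>u\<in>A. Poly_Mapping.lookup Q u * Poly_Mapping.lookup (stuffle q P (word u)) w)"
  proof (rule sum.mono_neutral_cong)
    fix u assume "u \<in> Poly_Mapping.keys Q - A"
    then have "\<not> weight u \<le> weight w" using assms(2) by auto
    then have "w \<notin> Poly_Mapping.keys (stuffle q P (word u))"
      by (auto elim!: keys_stuffle simp: keys_word)
    then show "Poly_Mapping.lookup Q u * Poly_Mapping.lookup (stuffle q P (word u)) w = 0"
      by (simp add: in_keys_iff)
  qed (use assms in \<open>auto simp: in_keys_iff\<close>)
  finally show ?thesis .
qed

lemma weight_eq_0_iff: "weight w = 0 \<longleftrightarrow> w = []"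
  using weight_Yplus[of w] by (cases "w = []") (simp_all add: Yplus_def)

lemma lookup_stuffle_words_list_Nil:
  assumes "us \<noteq> []" "set us \<subseteq> Yplus"
  shows "Poly_Mapping.lookup (stuffle_words_list q us) [] = 0"
proof (rule ccontr)
  assume "\<not> ?thesis"
  then have "(\<Sum>u\<leftarrow>us. weight u) = 0"
    using weight_stuffle_list[of "[]" q us] by (simp add: in_keys_iff)
  then show False using length_tuple_le[OF assms(2)] assms(1) by (simp del: sum_list_eq_0_iff)
qed

lemma lookup_pi1_check_Nil:
  assumes "w \<noteq> []"
  shows "Poly_Mapping.lookup (pi1_check q w) [] = 0"
proof -
  have "Poly_Mapping.lookup (stuffle_words_list q us) [] = 0" if "us \<in> splits w" for us
    using that assms by (intro lookup_stuffle_words_list_Nil) (auto simp: splits_def)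
  then show ?thesis
    using assms by (simp add: pi1_check_eq lookup_add lookup_sum lookup_smult lookup_word)
qed

lemma lookup_one: "Poly_Mapping.lookup (1 :: 'k::rat_algebra_1 ncpoly) w = (1 when w = [])"
  by (simp add: one_eq_word lookup_word when_def)

abbreviation (input) words_upto :: "nat \<Rightarrow> word set" where
  "words_upto N \<equiv> {u \<in> Yplus. weight u \<le> N}"

lemma finite_words_upto: "finite (words_upto N)"
  by (rule finite_subset[OF _ finite_words_weight[of N]]) auto

lemma sum_lists_Suc:
  assumes "finite B"
  shows "(\<Sum>us | set us \<subseteq> B \<and> length us = Suc k. F us) =
    (\<Sum>u\<in>B. \<Sum>us | set us \<subseteq> B \<and> length us = k. F (u # us))"
proof -
  have "(\<Sum>u\<in>B. \<Sum>us | set us \<subseteq> B \<and> length us = k. F (u # us)) =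
      (\<Sum>(u, us)\<in>B \<times> {us. set us \<subseteq> B \<and> length us = k}. F (u # us))"
    by (rule sum.cartesian_product)
  also have "\<dots> = (\<Sum>us | set us \<subseteq> B \<and> length us = Suc k. F us)"
    by (rule sum.reindex_bij_witness[where i = "\<lambda>us. (hd us, tl us)" and j = "\<lambda>(u, us). u # us"])
      (auto simp: length_Suc_conv)
  finally show ?thesis by simp
qed

lemma sum_swap4:
  "(\<Sum>u\<in>A. \<Sum>s\<in>T. \<Sum>p\<in>C. \<Sum>x\<in>W. f u s p x) =
   (\<Sum>p\<in>C. \<Sum>u\<in>A. \<Sum>x\<in>W. \<Sum>s\<in>T. f u s p x)"
proof -
  have "(\<Sum>u\<in>A. \<Sum>s\<in>T. \<Sum>p\<in>C. \<Sum>x\<in>W. f u s p x) = (\<Sum>u\<in>A. \<Sum>p\<in>C. \<Sum>s\<in>T. \<Sum>x\<in>W. f u s p x)"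
    by (rule sum.cong[OF refl]) (rule sum.swap)
  also have "\<dots> = (\<Sum>p\<in>C. \<Sum>u\<in>A. \<Sum>s\<in>T. \<Sum>x\<in>W. f u s p x)"
    by (rule sum.swap)
  also have "\<dots> = (\<Sum>p\<in>C. \<Sum>u\<in>A. \<Sum>x\<in>W. \<Sum>s\<in>T. f u s p x)"
    by (rule sum.cong[OF refl], rule sum.cong[OF refl]) (rule sum.swap)
  finally show ?thesis .
qed

text \<open>
  The bound \<open>N\<close> only makes the sum over the left-hand words finite; it is kept fixed
  because the induction passes from \<open>w\<close> to words of smaller weight.
\<close>

lemma pi1_duality:
  assumes "weight w \<le> N"
  shows "(\<Sum>us | set us \<subseteq> words_upto N \<and> length us = k.
      Poly_Mapping.lookup (stuffle_words_list q us) w * Poly_Mapping.lookup (prod_list (map (pi1 q) us)) v) =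
    (\<Sum>us | us \<in> splits v \<and> length us = k. Poly_Mapping.lookup (stuffle_list q (map (pi1_check q) us)) w)"
  using assms
proof (induction k arbitrary: v w)
  case 0
  have "{us. us \<in> splits v \<and> length us = 0} = (if v = [] then {[]} else {})"
    by (auto simp: splits_def)
  moreover have "{us. set us \<subseteq> words_upto N \<and> length us = 0} = {[]}" by auto
  ultimately show ?case by (simp add: lookup_one del: length_0_conv)
next
  case (Suc k)
  let ?B = "words_upto N" and ?W = "{x. weight x \<le> N}"
  let ?T = "{us. set us \<subseteq> ?B \<and> length us = k}"
  let ?S = "\<lambda>us. stuffle_words_list q us" and ?P = "\<lambda>us. prod_list (map (pi1 q) us)"
  let ?R = "\<lambda>b. \<Sum>us | us \<in> splits b \<and> length us = k. stuffle_list q (map (pi1_check q) us)"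
  let ?l = "Poly_Mapping.lookup"
  have W: "finite ?W" "{x. weight x \<le> weight w} \<subseteq> ?W"
    using finite_words_weight Suc.prems by auto
  \<comment> \<open>Split off the first word \<open>u\<close>, expand the rest of the \<star>
    product over words \<open>x\<close>, and cut \<open>v\<close> for the concatenation coefficient.
    The coefficient of \<open>a\<close> in \<open>pi1 q u\<close> becomes that of \<open>u\<close>
    in \<open>pi1_check q a\<close>.\<close>
  have "(\<Sum>us | set us \<subseteq> ?B \<and> length us = Suc k. ?l (?S us) w * ?l (?P us) v) =
      (\<Sum>u\<in>?B. \<Sum>us\<in>?T. \<Sum>(a, b)\<in>cuts v. \<Sum>x\<in>?W.
        ?l (pi1_check q a) u * ?l (stuffle q (word u) (word x)) w * (?l (?S us) x * ?l (?P us) b))"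
    unfolding sum_lists_Suc[OF finite_words_upto]
    by (intro sum.cong refl)
      (simp add: lookup_stuffle_right[OF W, of q "word _" "?S _"] lookup_times lookup_pi1
        sum_distrib_left sum_distrib_right case_prod_unfold mult_ac del: stuffle_word, rule sum.swap)
  also have "\<dots> = (\<Sum>(a, b)\<in>cuts v. \<Sum>u\<in>?B. \<Sum>x\<in>?W. \<Sum>us\<in>?T.
        ?l (pi1_check q a) u * ?l (stuffle q (word u) (word x)) w * (?l (?S us) x * ?l (?P us) b))"
    unfolding case_prod_unfold by (rule sum_swap4)
  \<comment> \<open>The induction hypothesis applies at \<open>x\<close> and \<open>b\<close>, since
    \<open>x\<close> ranges over words of weight at most \<open>N\<close>.\<close>
  also have "\<dots> = (\<Sum>(a, b)\<in>cuts v. \<Sum>u\<in>?B. \<Sum>x\<in>?W.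
        ?l (pi1_check q a) u * ?l (stuffle q (word u) (word x)) w * ?l (?R b) x)"
    unfolding sum_distrib_left[symmetric] lookup_sum
    by (intro sum.cong refl) (auto simp: Suc.IH)
  also have "\<dots> = (\<Sum>(a, b)\<in>cuts v. \<Sum>u\<in>?B. ?l (pi1_check q a) u * ?l (stuffle q (word u) (?R b)) w)"
    unfolding lookup_stuffle_right[OF W, of q "word _" "?R _"]
    by (simp add: sum_distrib_left mult_ac)
  \<comment> \<open>Here \<open>u\<close> ranges over nonempty words only. For \<open>a = []\<close>
    this gives 0, since \<open>pi1_check q []\<close> is the empty word; for other \<open>a\<close>
    nothing is lost, since \<open>pi1_check q a\<close> has no constant term.\<close>
  also have "\<dots> = (\<Sum>(a, b)\<in>cuts v. if a = [] then 0 else ?l (stuffle q (pi1_check q a) (?R b)) w)"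
  proof (intro sum.cong refl, clarify)
    fix a b
    show "(\<Sum>u\<in>?B. ?l (pi1_check q a) u * ?l (stuffle q (word u) (?R b)) w) =
      (if a = [] then 0 else ?l (stuffle q (pi1_check q a) (?R b)) w)"
    proof (cases "a = []")
      case True
      then show ?thesis by (auto simp: lookup_one Yplus_def intro!: sum.neutral)
    next
      case False
      have "?l (stuffle q (pi1_check q a) (?R b)) w =
          (\<Sum>u\<in>?W. ?l (pi1_check q a) u * ?l (stuffle q (word u) (?R b)) w)"
        by (rule lookup_stuffle_left[OF W])
      also have "\<dots> = (\<Sum>u\<in>?B. ?l (pi1_check q a) u * ?l (stuffle q (word u) (?R b)) w)"
        by (rule sum.mono_neutral_right)
          (use W lookup_pi1_check_Nil[OF False, of q] in \<open>auto simp: Yplus_def\<close>)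
      finally show ?thesis using False by simp
    qed
  qed
  also have "\<dots> = (\<Sum>us | us \<in> splits v \<and> length us = Suc k. ?l (stuffle_list q (map (pi1_check q) us)) w)"
    unfolding sum_splits_Suc by (intro sum.cong refl) (auto simp: stuffle_sum_right lookup_sum)
  finally show ?case .
qed

text \<open>Compare coefficients at \<open>v\<close>: duality turns the coefficient of
  \<open>v\<close> in this expansion of \<open>w\<close> into the coefficient of \<open>w\<close> in
  the dual expansion of \<open>v\<close>.\<close>

lemma exp_pi1:
  "word w = fsum UNIV (\<lambda>k. smult (rat_scalar (1 / fact k))
     (fsum (tuples k) (\<lambda>us. smult (pairing (word w) (stuffle_words_list q us)) (prod_list (map (pi1 q) us)))))"
    (is "_ = ?rhs")
proof (rule poly_mapping_eqI)
  fix v :: word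
  \<comment> \<open>The bound \<open>?N\<close> covers both kinds of lists: tuples whose \<star>
    product contains \<open>w\<close> have length at most \<open>weight w\<close>, and
    factorizations of \<open>v\<close> have length at most \<open>length v\<close>.\<close>
  let ?l = "Poly_Mapping.lookup" and ?B = "words_upto (weight w)" and ?N = "weight w + length v"
  let ?U = "{us. set us \<subseteq> ?B \<and> length us \<le> ?N}"
  have U: "finite ?U" by (rule finite_lists_length_le[OF finite_words_upto])
  have c: "?l (stuffle_words_list q us) w = 0" if "set us \<subseteq> Yplus" "us \<notin> ?U" for us
  proof (rule ccontr)
    assume "\<not> ?thesis"
    then have *: "weight w = (\<Sum>u\<leftarrow>us. weight u)"
      using weight_stuffle_list[of w q us] by (simp add: in_keys_iff)
    then have "weight u \<le> weight w" if "u \<in> set us" for u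
      using that by (auto intro: member_le_sum_list)
    then show False using that * length_tuple_le[of us] by auto
  qed
  have "?l ?rhs v = (\<Sum>us\<in>?U. rat_scalar (1 / fact (length us)) *
      (?l (stuffle_words_list q us) w * ?l (prod_list (map (pi1 q) us)) v))"
    by (subst fsum_fsum_tuples[OF U])
      (use c in \<open>auto simp: pairing_word lookup_sum lookup_smult mult_ac\<close>)
  also have "\<dots> = (\<Sum>k\<le>?N. \<Sum>us | us \<in> ?U \<and> length us = k. rat_scalar (1 / fact (length us)) *
      (?l (stuffle_words_list q us) w * ?l (prod_list (map (pi1 q) us)) v))"
    by (rule sum.group[symmetric]) (use U in auto)
  also have "\<dots> = (\<Sum>k\<le>?N. rat_scalar (1 / fact k) * (\<Sum>us | set us \<subseteq> ?B \<and> length us = k.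
      ?l (stuffle_words_list q us) w * ?l (prod_list (map (pi1 q) us)) v))"
    unfolding sum_distrib_left by (intro sum.cong) auto
  also have "\<dots> = ?l (\<Sum>us\<in>splits v. smult (rat_scalar (1 / fact (length us)))
      (stuffle_list q (map (pi1_check q) us))) w"
    unfolding pi1_duality[OF order_refl]
    by (subst sum_splits_group[of v ?N "\<lambda>n. rat_scalar (1 / fact n)", OF le_add2])
      (simp add: lookup_sum lookup_smult)
  also have "\<dots> = ?l (word w) v"
    by (simp flip: exp_pi1_check add: lookup_word when_def eq_commute)
  finally show "?l (word w) v = ?l ?rhs v" by simp
qed

lemma exp_pi1_check_fsum:
  "word w = fsum UNIV (\<lambda>k. smult (rat_scalar (1 / fact k))
     (fsum (tuples k) (\<lambda>us. smult (pairing (word w) (prod_list (map word us)))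
       (stuffle_list q (map (pi1_check q) us)))))" (is "_ = ?rhs")
proof -
  have "?rhs = (\<Sum>us\<in>splits w. smult (rat_scalar (1 / fact (length us)) *
      pairing (word w) (prod_list (map word us))) (stuffle_list q (map (pi1_check q) us)))"
    by (subst fsum_fsum_tuples[where U = "splits w"])
      (auto simp: pairing_word prod_list_word lookup_word, auto simp: splits_def)
  also have "\<dots> = word w"
    by (subst exp_pi1_check[of w q], intro sum.cong)
      (auto simp: splits_def pairing_word prod_list_word lookup_word)
  finally show ?thesis by (rule sym)
qed

section \<open>The logarithm of the diagonal series\<close>

text \<open>The series \<D> - 1 is supported on pairs \<open>(a, a)\<close> with \<open>a\<close>
  nonempty, so multiplying by it from the left prepends one factor to a factorization.\<close>

lemma ts_power_diagonal:
  "ts_power q (\<lambda>u v. diagonal u v - ts_one u v) k u v =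
   (\<Sum>us | us \<in> splits v \<and> length us = k. Poly_Mapping.lookup (stuffle_words_list q us) u)"
proof (induction k arbitrary: u v)
  case 0
  have "{us. us \<in> splits v \<and> length us = 0} = (if v = [] then {[]} else {})"
    by (auto simp: splits_def)
  then show ?case by (simp add: ts_power_def ts_one_def tensor_def lookup_one del: length_0_conv)
next
  case (Suc k)
  let ?l = "Poly_Mapping.lookup"
  let ?X = "\<lambda>u v. diagonal u v - ts_one u v :: 'a"
  let ?C = "{(a, b). (a, b) \<in> cuts v \<and> a \<noteq> []}" and ?W = "{x. weight x \<le> weight u}"
  \<comment> \<open>Parametrizes the index quadruples that can contribute: the first series forces
    equal words \<open>a\<close>, concatenation forces a cut of \<open>v\<close>, and the left word
    \<open>x\<close> of the second series has bounded weight.\<close>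
  let ?g = "\<lambda>((a, b), x). ((a, a), (x, b)) :: (word \<times> word) \<times> (word \<times> word)"
  let ?f = "\<lambda>((u1, v1), (u2, v2)). ?X u1 v1 * ts_power q ?X k u2 v2 *
     tensor (stuffle q (word u1) (word u2)) (word v1 * word v2) u v"
  let ?R = "\<lambda>b. \<Sum>us | us \<in> splits b \<and> length us = k. stuffle_words_list q us"
  have X: "?X a b = (1 when a = b \<and> a \<noteq> [])" for a b
    by (auto simp: diagonal_eq ts_one_def tensor_def lookup_one when_def)
  have C: "finite ?C" by (rule finite_subset[OF _ finite_cuts[of v]]) auto
  have W: "finite ?W" "{x. weight x \<le> weight u} \<subseteq> ?W"
    using finite_words_weight by auto
  have "ts_power q ?X (Suc k) u v = fsum UNIV ?f"
    by (simp add: ts_power_def ts_mult_def)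
  also have "\<dots> = sum ?f (?g ` (?C \<times> ?W))"
  proof (rule fsum_eq_sum)
    fix i assume i: "i \<in> UNIV - ?g ` (?C \<times> ?W)"
    obtain u1 v1 u2 v2 where [simp]: "i = ((u1, v1), (u2, v2))" by (metis surj_pair)
    show "?f i = 0"
    proof (rule ccontr)
      assume nz: "?f i \<noteq> 0"
      then have t: "tensor (stuffle q (word u1) (word u2)) (word v1 * word v2) u v \<noteq> 0"
        and x: "?X u1 v1 \<noteq> 0" by auto
      have "u1 = v1" "v1 \<noteq> []" using x unfolding X by (simp_all add: when_def split: if_splits)
      moreover have "v1 @ v2 = v" using t
        by (auto simp: tensor_def word_mult lookup_word when_def split: if_splits)
      moreover have "weight u2 \<le> weight u" using ts_mult_term_weight(1)[OF t] by simp
      ultimately have "i = ?g ((v1, v2), u2)" "((v1, v2), u2) \<in> ?C \<times> ?W" by (auto simp: cuts_def)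
      then show False using i by blast
    qed
  qed (use C W in auto)
  also have "\<dots> = (\<Sum>p\<in>?C \<times> ?W. ?f (?g p))"
    by (subst sum.reindex) (auto simp: inj_on_def)
  also have "\<dots> = (\<Sum>(p, x)\<in>?C \<times> ?W. ?l (?R (snd p)) x * ?l (stuffle q (word (fst p)) (word x)) u)"
    unfolding Suc.IH
    by (intro sum.cong refl) (auto simp: X tensor_def cuts_def word_mult lookup_word lookup_sum)
  also have "\<dots> = (\<Sum>p\<in>?C. \<Sum>x\<in>?W. ?l (?R (snd p)) x * ?l (stuffle q (word (fst p)) (word x)) u)"
    by (rule sum.cartesian_product[symmetric])
  also have "\<dots> = (\<Sum>p\<in>?C. ?l (stuffle q (word (fst p)) (?R (snd p))) u)"
    by (simp only: lookup_stuffle_right[OF W, of q "word _" "?R _"])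
  also have "\<dots> = (\<Sum>(a, b)\<in>cuts v. if a = [] then 0 else ?l (stuffle q (word a) (?R b)) u)"
    by (rule sum.mono_neutral_cong_left) (auto split: if_splits)
  also have "\<dots> = (\<Sum>us | us \<in> splits v \<and> length us = Suc k. ?l (stuffle_words_list q us) u)"
    unfolding sum_splits_Suc by (intro sum.cong refl) (auto simp: stuffle_sum_right lookup_sum)
  finally show ?case .
qed

lemma ts_log_diagonal:
  "ts_log q diagonal u v = Poly_Mapping.lookup (conv_series q (fps_ln 1) v) u"
proof -
  let ?l = "Poly_Mapping.lookup"
  have "ts_log q diagonal u v = fsum {1..} (\<lambda>k. rat_scalar ((- 1) ^ (k - 1) / of_nat k) *
      (\<Sum>us | us \<in> splits v \<and> length us = k. ?l (stuffle_words_list q us) u))"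
    by (simp add: ts_log_def ts_sum_def ts_power_diagonal)
  \<comment> \<open>A word has no factorization into more nonempty factors than it has
    letters.\<close>
  also have "\<dots> = (\<Sum>k\<in>{1..length v}. rat_scalar ((- 1) ^ (k - 1) / of_nat k) *
      (\<Sum>us | us \<in> splits v \<and> length us = k. ?l (stuffle_words_list q us) u))"
  proof (rule fsum_eq_sum)
    fix k assume "k \<in> {1..} - {1..length v}"
    then have *: "{us. us \<in> splits v \<and> length us = k} = {}" using length_splits_le by fastforce
    show "rat_scalar ((- 1) ^ (k - 1) / of_nat k) *
      (\<Sum>us | us \<in> splits v \<and> length us = k. ?l (stuffle_words_list q us) u) = 0"
      unfolding * by simp
  qed auto
  \<comment> \<open>The added index \<open>k = 0\<close> contributes nothing because the constant
    term of \<open>fps_ln 1\<close> is 0.\<close>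
  also have "\<dots> = (\<Sum>k\<le>length v. rat_scalar (fps_nth (fps_ln 1) k) *
      (\<Sum>us | us \<in> splits v \<and> length us = k. ?l (stuffle_words_list q us) u))"
    by (rule sum.mono_neutral_cong_left) (auto simp: fps_ln_nth not_le)
  also have "\<dots> = ?l (conv_series q (fps_ln 1) v) u"
    unfolding conv_series_def sum_splits_group[OF order_refl, where d = "\<lambda>n. rat_scalar (fps_nth (fps_ln 1) n)"]
    by (simp add: lookup_sum lookup_smult)
  finally show ?thesis .
qed

lemma conv_series_ln: "conv_series q (fps_ln 1) w = (if w = [] then 0 else pi1_check q w)"
  by (auto simp: pi1_check_conv_series) (simp add: conv_series_def)

lemma ts_log_diagonal_pi1_check:
  "ts_log q diagonal = ts_sum Yplus (\<lambda>w. tensor (pi1_check q w) (word w))"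
proof (intro ext)
  fix u v
  have "ts_sum Yplus (\<lambda>w. tensor (pi1_check q w) (word w)) u v =
      (\<Sum>w\<in>{v} \<inter> Yplus. Poly_Mapping.lookup (pi1_check q w) u * (1 when w = v))"
    unfolding ts_sum_def tensor_def lookup_word by (rule fsum_eq_sum) (auto simp: when_def)
  also have "\<dots> = Poly_Mapping.lookup (conv_series q (fps_ln 1) v) u"
    by (auto simp: conv_series_ln Yplus_def)
  finally show "ts_log q diagonal u v = ts_sum Yplus (\<lambda>w. tensor (pi1_check q w) (word w)) u v"
    by (simp add: ts_log_diagonal)
qed

lemma ts_log_diagonal_pi1:
  "ts_log q diagonal = ts_sum Yplus (\<lambda>w. tensor (word w) (pi1 q w))"
proof (intro ext)
  fix u v
  have "ts_sum Yplus (\<lambda>w. tensor (word w) (pi1 q w)) u v =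
      (\<Sum>w\<in>{u} \<inter> Yplus. (1 when w = u) * Poly_Mapping.lookup (pi1 q w) v)"
    unfolding ts_sum_def tensor_def lookup_word by (rule fsum_eq_sum) (auto simp: when_def)
  \<comment> \<open>For \<open>u = []\<close> the left side is an empty sum, and the right side
    vanishes because the logarithm has no term with an empty left word.\<close>
  also have "\<dots> = Poly_Mapping.lookup (conv_series q (fps_ln 1) v) u"
    by (cases "u = []") (auto simp: conv_series_ln Yplus_def lookup_pi1 lookup_pi1_check_Nil lookup_one)
  finally show "ts_log q diagonal u v = ts_sum Yplus (\<lambda>w. tensor (word w) (pi1 q w)) u v"
    by (simp add: ts_log_diagonal)
qed

section \<open>Expansion of a letter\<close>

lemma lookup_letter_mult:
  "Poly_Mapping.lookup (word [a] * P) (c # w) = (Poly_Mapping.lookup P w when a = c)"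
  by (induction P rule: ncpoly_induct)
    (auto simp: distrib_left times_smult lookup_add lookup_smult word_mult lookup_word when_def)

lemma lookup_stuffle_words_Nil:
  "Poly_Mapping.lookup (stuffle_words q u v) [] = (1 when u = [] \<and> v = [])"
proof (cases "u = [] \<and> v = []")
  case False
  then have "weight u + weight v \<noteq> 0" by (auto simp: weight_eq_0_iff)
  then have "[] \<notin> Poly_Mapping.keys (stuffle_words q u v)"
    using weight_stuffle_words[of "[]" q u v] by auto
  then show ?thesis using False by (auto simp: in_keys_iff)
qed (simp add: lookup_word)

text \<open>The strict inequality keeps \<open>index c - index a\<close> at least 1, the range on
  which \<open>y\<close> inverts \<open>index\<close>.\<close>

lemma y_add_eq_iff: "y (index a + index b) = c \<longleftrightarrow> index a < index c \<and> b = y (index c - index a)"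
proof -
  have "index (y (index a + index b)) = index a + index b" using index_pos[of a] by (simp add: y_inverse)
  moreover have "index (y (index c - index a)) = index c - index a" if "index a < index c"
    using that by (simp add: y_inverse)
  ultimately show ?thesis
    using index_pos[of b] by (auto simp flip: index_inject)
qed

text \<open>Two nonempty words produce a single letter only by merging, which requires both to be
  letters and costs one factor \<open>q\<close>.\<close>

lemma lookup_stuffle_letter:
  "Poly_Mapping.lookup (stuffle q (word (a # u)) P) [c] =
     Poly_Mapping.lookup P [] * (1 when a # u = [c]) +
     (if u = [] \<and> index a < index c then q * Poly_Mapping.lookup P [y (index c - index a)] else 0)"
proof (induction P rule: ncpoly_induct)
  case (word v)
  show ?case
    by (cases v)
      (auto simp: lookup_word lookup_add lookup_smult lookup_letter_mult lookup_stuffle_words_Nil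
        y_add_eq_iff when_def)
qed (auto simp: stuffle_linear lookup_add lookup_smult algebra_simps)

text \<open>Every factor must be a letter, and merging all of them into one takes
  \<open>length us - 1\<close> merges.\<close>

lemma lookup_stuffle_words_list_letter:
  assumes "us \<noteq> []" "set us \<subseteq> Yplus"
  shows "Poly_Mapping.lookup (stuffle_words_list q us) [c] =
    (q ^ (length us - 1) when (\<forall>u\<in>set us. length u = 1) \<and> (\<Sum>u\<leftarrow>us. weight u) = index c)"
  using assms
proof (induction us arbitrary: c)
  case (Cons u us)
  obtain a u' where u: "u = a # u'" using Cons.prems by (cases u) (auto simp: Yplus_def)
  show ?case
  proof (cases "us = []")
    case True
    then show ?thesis
      by (auto simp: u lookup_word when_def weight_eq_0_iff index_inject)
  next
    case False
    then have us: "1 \<le> (\<Sum>u\<leftarrow>us. weight u)"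
      using Cons.prems length_tuple_le[of us] by (cases us) auto
    have qpow: "q * q ^ (length us - 1) = q ^ length us"
      using False by (cases us) simp_all
    have i: "index (y (index c - index a)) = index c - index a" if "index a < index c"
      using that by (simp add: y_inverse)
    have "Poly_Mapping.lookup (stuffle_words_list q (u # us)) [c] =
      (if u' = [] \<and> index a < index c
       then q * Poly_Mapping.lookup (stuffle_words_list q us) [y (index c - index a)] else 0)"
      using Cons.prems False by (simp add: u lookup_stuffle_letter lookup_stuffle_words_list_Nil)
    also have "\<dots> = (if u' = [] \<and> index a < index c then (q ^ length us when
        (\<forall>u\<in>set us. length u = 1) \<and> (\<Sum>u\<leftarrow>us. weight u) = index c - index a) else 0)"
      using Cons.IH[OF False] Cons.prems i by (auto simp: when_def simp flip: qpow)
    \<comment> \<open>The remaining factors have positive total weight, so equality of the total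
      with \<open>index c\<close> already forces \<open>index a < index c\<close>.\<close>
    also have "\<dots> = (q ^ length us when
        (\<forall>u\<in>set (u # us). length u = 1) \<and> (\<Sum>u\<leftarrow>u # us. weight u) = index c)"
      using us by (auto simp: u when_def)
    finally show ?thesis by simp
  qed
qed simp

text \<open>Only tuples of letters contribute, and those of total weight \<open>s\<close> correspond
  to compositions of \<open>s\<close> into \<open>k\<close> parts, with \<open>weight\<close>
  recovering the parts.\<close>

lemma fsum_tuples_letter:
  assumes s: "1 \<le> s" and k: "1 \<le> k"
  shows "fsum (tuples k) (\<lambda>us. smult (pairing (word [y s]) (stuffle_words_list q us)) (prod_list (map f us))) =
    smult (q ^ (k - 1)) (\<Sum>ss | length ss = k \<and> (\<forall>s' \<in> set ss. 1 \<le> s') \<and> sum_list ss = s.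
      prod_list (map (\<lambda>s'. f [y s']) ss))"
proof -
  let ?C = "{ss. length ss = k \<and> (\<forall>s' \<in> set ss. 1 \<le> s') \<and> sum_list ss = s}"
  let ?m = "map (\<lambda>s'. [y s'])"
  have ind: "index (y t) = t" if "1 \<le> t" for t using that by (simp add: y_inverse)
  have sw: "(\<Sum>u\<leftarrow>?m ss. weight u) = sum_list ss" if "\<forall>s'\<in>set ss. 1 \<le> s'" for ss
    using that by (induction ss) (auto simp: ind)
  have coeff: "pairing (word [y s]) (stuffle_words_list q us) =
     (q ^ (k - 1) when (\<forall>u\<in>set us. length u = 1) \<and> (\<Sum>u\<leftarrow>us. weight u) = s)" if "us \<in> tuples k" for us
    using that k s by (subst pairing_word, subst lookup_stuffle_words_list_letter) (auto simp: tuples_def ind)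
  have "fsum (tuples k) (\<lambda>us. smult (pairing (word [y s]) (stuffle_words_list q us)) (prod_list (map f us))) =
     (\<Sum>us\<in>?m ` ?C. smult (pairing (word [y s]) (stuffle_words_list q us)) (prod_list (map f us)))"
  proof (rule fsum_eq_sum)
    show "finite (?m ` ?C)" by (intro finite_imageI finite_compositions)
    show "?m ` ?C \<subseteq> tuples k" by (auto simp: tuples_def Yplus_def)
    fix us assume us: "us \<in> tuples k - ?m ` ?C"
    have no: "\<not> ((\<forall>u\<in>set us. length u = 1) \<and> (\<Sum>u\<leftarrow>us. weight u) = s)"
    proof
      assume *: "(\<forall>u\<in>set us. length u = 1) \<and> (\<Sum>u\<leftarrow>us. weight u) = s"
      have "[y (weight u)] = u" if "u \<in> set us" for u
        using * that by (auto simp: length_Suc_conv index_inverse)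
      then have "us = ?m (map weight us)" by (simp add: map_idI)
      moreover have "map weight us \<in> ?C"
        using us * weight_Yplus by (force simp: tuples_def)
      ultimately show False using us by blast
    qed
    have "us \<in> tuples k" using us by blast
    from coeff[OF this] no have "pairing (word [y s]) (stuffle_words_list q us) = 0"
      by (simp only: when_def if_False)
    then show "smult (pairing (word [y s]) (stuffle_words_list q us)) (prod_list (map f us)) = 0"
      by simp
  qed
  also have "\<dots> = (\<Sum>ss\<in>?C. smult (pairing (word [y s]) (stuffle_words_list q (?m ss))) (prod_list (map f (?m ss))))"
  proof (subst sum.reindex)
    show "inj_on ?m ?C"
    proof (rule inj_onI)
      fix ss ts assume ss: "ss \<in> ?C" and ts: "ts \<in> ?C" and eq: "?m ss = ?m ts"
      have "map weight (?m ss) = ss" if "ss \<in> ?C" for ss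
        using that by (auto simp: ind intro!: map_idI)
      from this[OF ss] this[OF ts] eq show "ss = ts" by argo
    qed
  qed simp
  also have "\<dots> = (\<Sum>ss\<in>?C. smult (q ^ (k - 1)) (prod_list (map (\<lambda>s'. f [y s']) ss)))"
  proof (intro sum.cong refl)
    fix ss assume ss: "ss \<in> ?C"
    then have "?m ss \<in> tuples k" by (auto simp: tuples_def Yplus_def)
    from coeff[OF this] have "pairing (word [y s]) (stuffle_words_list q (?m ss)) = q ^ (k - 1)"
      using ss sw[of ss] by (simp add: when_def del: map_map)
    then show "smult (pairing (word [y s]) (stuffle_words_list q (?m ss))) (prod_list (map f (?m ss))) =
      smult (q ^ (k - 1)) (prod_list (map (\<lambda>s'. f [y s']) ss))"
      by (simp add: o_def)
  qed
  finally show ?thesis by (simp add: smult_sum)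
qed

lemma letter_expansion:
  assumes "1 \<le> s"
  shows "word [y s] = fsum {1..} (\<lambda>k. smult (rat_scalar (1 / fact k) * q ^ (k - 1))
    (\<Sum>ss | length ss = k \<and> (\<forall>s' \<in> set ss. 1 \<le> s') \<and> sum_list ss = s.
       prod_list (map (\<lambda>s'. pi1 q [y s']) ss)))"
proof -
  let ?G = "\<lambda>k. smult (rat_scalar (1 / fact k)) (fsum (tuples k) (\<lambda>us.
     smult (pairing (word [y s]) (stuffle_words_list q us)) (prod_list (map (pi1 q) us))))"
  \<comment> \<open>The only tuple of length 0 gives the empty word, which has no coefficient at a
    letter, so the sum may start at \<open>k = 1\<close>.\<close>
  have "pairing (word [y s]) (stuffle_words_list q us) = 0" if "us \<in> tuples 0" for us
    using that by (simp add: tuples_def pairing_word lookup_one)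
  then have "fsum (tuples 0) (\<lambda>us. smult (pairing (word [y s]) (stuffle_words_list q us))
      (prod_list (map (pi1 q) us))) = 0"
    by (intro fsum_neutral) simp
  then have G0: "?G 0 = 0" by simp
  have "word [y s] = fsum UNIV ?G" by (rule exp_pi1)
  also have "\<dots> = fsum {1..} ?G"
    unfolding fsum_def[of UNIV] fsum_def[of "{1..}"]
    by (rule arg_cong[where f = Sum_any], rule ext) (use G0 in \<open>auto simp: when_def not_le\<close>)
  also have "\<dots> = fsum {1..} (\<lambda>k. smult (rat_scalar (1 / fact k) * q ^ (k - 1))
    (\<Sum>ss | length ss = k \<and> (\<forall>s' \<in> set ss. 1 \<le> s') \<and> sum_list ss = s.
       prod_list (map (\<lambda>s'. pi1 q [y s']) ss)))"
    unfolding fsum_def[of "{1..}"]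
    by (rule arg_cong[where f = Sum_any], rule ext)
      (use assms in \<open>auto simp: when_def fsum_tuples_letter smult_smult\<close>)
  finally show ?thesis .
qed

theorem proposition1:
  fixes q :: "'k::rat_algebra_1"
  shows
    "ts_log q diagonal = ts_sum Yplus (\<lambda>w. tensor (word w) (pi1 q w)) \<and>
     ts_log q diagonal = ts_sum Yplus (\<lambda>w. tensor (pi1_check q w) (word w)) \<and>
     (\<forall>w :: word.
        (word w :: 'k ncpoly) =
          fsum UNIV (\<lambda>k. smult (rat_scalar (1 / fact k))
            (fsum (tuples k) (\<lambda>us.
               smult (pairing (word w) (stuffle_list q (map word us)))
                 (prod_list (map (pi1 q) us))))) \<and>
        (word w :: 'k ncpoly) =
          fsum UNIV (\<lambda>k. smult (rat_scalar (1 / fact k))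
            (fsum (tuples k) (\<lambda>us.
               smult (pairing (word w) (prod_list (map word us)))
                 (stuffle_list q (map (pi1_check q) us)))))) \<and>
     (\<forall>s :: nat. 1 \<le> s \<longrightarrow>
        (word [y s] :: 'k ncpoly) =
          fsum {1..} (\<lambda>k. smult (rat_scalar (1 / fact k) * q ^ (k - 1))
            (\<Sum>ss | length ss = k \<and> (\<forall>s' \<in> set ss. 1 \<le> s') \<and> sum_list ss = s.
               prod_list (map (\<lambda>s'. pi1 q [y s']) ss))) \<and>
        (word [y s] :: 'k ncpoly) = pi1_check q [y s])"
proof (intro conjI allI impI)
  fix s :: nat
  \<comment> \<open>A single letter has no factorization into two or more nonempty words, so every
    correction term of \<open>pi1_check\<close> disappears.\<close>
  have "{us. us \<in> splits [y s] \<and> length us \<in> {2..}} = {}"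
    using length_splits_le[of _ "[y s]"] by fastforce
  then show "word [y s] = pi1_check q [y s]"
    unfolding pi1_check_eq by (simp only: sum.empty add_0_right)
qed (rule ts_log_diagonal_pi1 ts_log_diagonal_pi1_check exp_pi1 exp_pi1_check_fsum letter_expansion; assumption?)+

end
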